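(* Let $I$ be an ideal minimally generated by $q\ge 1$ square-free monomials in a polynomial ring $R=\mathsf{k}[x_1,\dots,x_n]$ over a field $\mathsf{k}$, and let $r$ be a positive integer. Then $$\overline{I^r}=\psi_I\big(\overline{\mathcal{E}_q^{\,r}}\big)R\quad\text{and}\quad I^{(r)}=\psi_I\big(\mathcal{E}_q^{(r)}\big)R .$$
   Context: Let $\mathsf{k}$ be a field, $q\ge 1$, $[q]=\{1,\dots,q\}$, and $S_{[q]}=\mathsf{k}[y_A : \emptyset\neq A\subseteq[q]]$ (one variable for each nonempty subset of $[q]$). For $i\in[q]$ set $\epsilon_i=\prod_{A\subseteq[q],\, i\in A}y_A$. The $q$-extremal ideal is $\mathcal{E}_q=(\epsilon_1,\dots,\epsilon_q)\subseteq S_{[q]}$. If $m_1,\dots,m_q$ are the minimal square-free monomial generators of $I\subseteq R=\mathsf{k}[x_1,\dots,x_n]$, then $\psi_I\colon S_{[q]}\to R$ is the $\mathsf{k}$-algebra homomorphism with $\psi_I(y_A)$ equal to the product of all variables $x_k$ ($k\in[n]$) such that for every $j\in[q]$: $x_k\mid m_j \iff j\in A$ (empty product $=1$). For an ideal $J$ of $S_{[q]}$, $\psi_I(J)R$ is the ideal of $R$ generated by $\psi_I(J)$. $\overline{J}$ denotes the integral closure of an ideal $J$ (in its ambient polynomial ring), and the $r$-th symbolic power of an ideal $J$ of a polynomial ring $T$ is $J^{(r)}=\bigcap_{P\in\mathrm{Min}(J)}(J^rT_P\cap T)$, where $\mathrm{Min}(J)$ is the set of minimal primes of $J$ (for a square-free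 monomial ideal, $J^{(r)}=\bigcap_{P\in\mathrm{Min}(J)}P^r$). *)

theory Defs
  imports "HOL-Library.Poly_Mapping" "HOL-Algebra.Ideal_Product" "HOL-Algebra.Divisibility"
begin

section \<open>Polynomial rings in a prescribed set of variables\<close>

type_synonym ('v, 'k) mpoly = "('v \<Rightarrow>\<^sub>0 nat) \<Rightarrow>\<^sub>0 'k"

definition var :: "'v \<Rightarrow> ('v, 'k::comm_ring_1) mpoly"
  where "var v = Poly_Mapping.single (Poly_Mapping.single v 1) 1"

definition const :: "'k \<Rightarrow> ('v, 'k::comm_ring_1) mpoly"
  where "const c = Poly_Mapping.single 0 c"

definition vars :: "('v, 'k::comm_ring_1) mpoly \<Rightarrow> 'v set"
  where "vars p = (\<Union>t\<in>Poly_Mapping.keys p. Poly_Mapping.keys t)"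

text \<open>The ring of all polynomials involving only variables from \<open>V\<close>. The variables are
  a set rather than a type so that the number of variables can be an arbitrary natural number.\<close>

definition poly_ring :: "'v set \<Rightarrow> ('v, 'k::comm_ring_1) mpoly ring"
  where "poly_ring V =
    \<lparr>carrier = {p. vars p \<subseteq> V}, monoid.mult = (*), one = 1, zero = 0, add = (+)\<rparr>"

text \<open>Substitution of \<open>f v\<close> for each variable \<open>v\<close>, i.e.\ the homomorphism of algebras over
  the coefficients given by \<open>var v \<mapsto> f v\<close>.\<close>

definition monom_subst ::
    "('v \<Rightarrow> ('w, 'k) mpoly) \<Rightarrow> ('v \<Rightarrow>\<^sub>0 nat) \<Rightarrow> ('w, 'k::comm_ring_1) mpoly"
  where "monom_subst f t = (\<Prod>v\<in>Poly_Mapping.keys t. f v ^ Poly_Mapping.lookup t v)"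

definition poly_subst ::
    "('v \<Rightarrow> ('w, 'k) mpoly) \<Rightarrow> ('v, 'k) mpoly \<Rightarrow> ('w, 'k::comm_ring_1) mpoly"
  where "poly_subst f p =
    (\<Sum>t\<in>Poly_Mapping.keys p. const (Poly_Mapping.lookup p t) * monom_subst f t)"

definition squarefree_monomial :: "'v set \<Rightarrow> ('v, 'k::comm_ring_1) mpoly \<Rightarrow> bool"
  where "squarefree_monomial V p \<longleftrightarrow>
    (\<exists>t. Poly_Mapping.keys t \<subseteq> V \<and> (\<forall>v. Poly_Mapping.lookup t v \<le> 1) \<and>
         p = Poly_Mapping.single t 1)"


subsection \<open>Basic properties\<close>

lemma vars_mult: "vars (p * q) \<subseteq> vars p \<union> vars q"
proof
  fix v assume "v \<in> vars (p * q)"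
  then obtain t where t: "t \<in> Poly_Mapping.keys (p * q)" and v: "v \<in> Poly_Mapping.keys t"
    by (auto simp: vars_def)
  from t keys_mult obtain a b
    where "t = a + b" "a \<in> Poly_Mapping.keys p" "b \<in> Poly_Mapping.keys q"
    by blast
  then show "v \<in> vars p \<union> vars q"
    using v keys_add[of a b] by (auto simp: vars_def)
qed

lemma vars_add: "vars (p + q) \<subseteq> vars p \<union> vars q"
  using keys_add[of p q] by (auto simp: vars_def)

lemma vars_uminus [simp]: "vars (- p) = vars p"
  by (simp add: vars_def)

lemma vars_zero [simp]: "vars 0 = {}"
  by (simp add: vars_def)

lemma vars_one [simp]: "vars 1 = {}"
  by (simp add: vars_def)

lemma vars_const [simp]: "vars (const c) = {}"
  by (simp add: vars_def const_def)

lemma vars_var [simp]: "vars (var v :: ('v, 'k::comm_ring_1) mpoly) = {v}"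
  by (simp add: vars_def var_def)

lemma cring_poly_ring: "cring (poly_ring V)"
proof (rule cringI)
  show "abelian_group (poly_ring V)"
  proof (rule abelian_groupI)
    fix p assume "p \<in> carrier (poly_ring V)"
    then show "\<exists>q\<in>carrier (poly_ring V). q \<oplus>\<^bsub>poly_ring V\<^esub> p = \<zero>\<^bsub>poly_ring V\<^esub>"
      by (intro bexI[of _ "- p"]) (auto simp: poly_ring_def)
  qed (use vars_add in \<open>fastforce simp: poly_ring_def algebra_simps\<close>)+
  show "comm_monoid (poly_ring V)"
    by (rule comm_monoidI) (use vars_mult in \<open>fastforce simp: poly_ring_def algebra_simps\<close>)+
qed (auto simp: poly_ring_def algebra_simps)

lemma monom_subst_superset:
  assumes "finite A" "Poly_Mapping.keys t \<subseteq> A"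
  shows "monom_subst f t = (\<Prod>v\<in>A. f v ^ Poly_Mapping.lookup t v)"
  unfolding monom_subst_def using assms
  by (intro prod.mono_neutral_left) (auto simp: in_keys_iff)

lemma monom_subst_add: "monom_subst f (s + t) = monom_subst f s * monom_subst f t"
proof -
  let ?A = "Poly_Mapping.keys s \<union> Poly_Mapping.keys t"
  have "monom_subst f (s + t) = (\<Prod>v\<in>?A. f v ^ Poly_Mapping.lookup (s + t) v)"
    using keys_add[of s t] by (intro monom_subst_superset) auto
  also have "\<dots> = (\<Prod>v\<in>?A. f v ^ Poly_Mapping.lookup s v) * (\<Prod>v\<in>?A. f v ^ Poly_Mapping.lookup t v)"
    by (simp add: lookup_add power_add prod.distrib)
  also have "\<dots> = monom_subst f s * monom_subst f t"
    by (simp add: monom_subst_superset[of ?A])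
  finally show ?thesis .
qed

lemma const_add: "const (a + b) = const a + const b"
  by (simp add: const_def single_add)

lemma const_mult: "const (a * b) = const a * const b"
  by (simp add: const_def mult_single)

lemma const_zero [simp]: "const 0 = 0"
  by (simp add: const_def)

lemma const_one [simp]: "const 1 = 1"
  by (simp add: const_def)

lemma poly_subst_add: "poly_subst f (p + q) = poly_subst f p + poly_subst f q"
  unfolding poly_subst_def
  by (rule setsum_keys_plus_distrib) (simp_all add: const_add algebra_simps)

lemma poly_subst_single:
  "poly_subst f (Poly_Mapping.single t c) = const c * monom_subst f t"
  by (simp add: poly_subst_def)

lemma poly_subst_zero [simp]: "poly_subst f 0 = 0"
  by (simp add: poly_subst_def)

lemma poly_subst_sum: "poly_subst f (sum g A) = (\<Sum>a\<in>A. poly_subst f (g a))"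
  by (induction A rule: infinite_finite_induct) (simp_all add: poly_subst_add)

lemma mpoly_as_sum:
  "p = (\<Sum>t\<in>Poly_Mapping.keys p. Poly_Mapping.single t (Poly_Mapping.lookup p t))"
proof (rule poly_mapping_eqI)
  fix s
  have "(\<Sum>t\<in>Poly_Mapping.keys p. Poly_Mapping.lookup p t when t = s) = Poly_Mapping.lookup p s"
    by (auto simp: when_def in_keys_iff)
  then show "Poly_Mapping.lookup p s = Poly_Mapping.lookup
      (\<Sum>t\<in>Poly_Mapping.keys p. Poly_Mapping.single t (Poly_Mapping.lookup p t)) s"
    by (simp add: lookup_sum lookup_single)
qed

lemma poly_subst_mult: "poly_subst f (p * q) = poly_subst f p * poly_subst f q"
proof -
  let ?P = "Poly_Mapping.keys p" and ?Q = "Poly_Mapping.keys q"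
  have "p * q = (\<Sum>s\<in>?P. \<Sum>t\<in>?Q.
      Poly_Mapping.single (s + t) (Poly_Mapping.lookup p s * Poly_Mapping.lookup q t))"
    by (subst mpoly_as_sum[of p], subst mpoly_as_sum[of q])
       (simp add: sum_product mult_single)
  then have "poly_subst f (p * q) = (\<Sum>s\<in>?P. \<Sum>t\<in>?Q.
      const (Poly_Mapping.lookup p s * Poly_Mapping.lookup q t) * monom_subst f (s + t))"
    by (simp add: poly_subst_sum poly_subst_single)
  also have "\<dots> = poly_subst f p * poly_subst f q"
    by (simp add: poly_subst_def sum_product const_mult monom_subst_add mult_ac)
  finally show ?thesis .
qed

lemma poly_subst_const [simp]: "poly_subst f (const c) = const c"
  unfolding const_def[of c] by (simp add: poly_subst_single monom_subst_def const_def)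

lemma poly_subst_var [simp]: "poly_subst f (var v) = f v"
  by (simp add: var_def poly_subst_single monom_subst_def)

lemma poly_subst_one [simp]: "poly_subst f 1 = 1"
  using poly_subst_const[of f 1] by simp

lemma vars_prod: "(\<And>a. a \<in> A \<Longrightarrow> vars (g a) \<subseteq> W) \<Longrightarrow> vars (prod g A) \<subseteq> W"
proof (induction A rule: infinite_finite_induct)
  case (insert a A)
  then show ?case using vars_mult[of "g a" "prod g A"] by auto
qed simp_all

lemma vars_sum: "(\<And>a. a \<in> A \<Longrightarrow> vars (g a) \<subseteq> W) \<Longrightarrow> vars (sum g A) \<subseteq> W"
proof (induction A rule: infinite_finite_induct)
  case (insert a A)
  then show ?case using vars_add[of "g a" "sum g A"] by auto
qed simp_all

lemma vars_power: "vars p \<subseteq> W \<Longrightarrow> vars (p ^ k) \<subseteq> W"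
proof (induction k)
  case (Suc k)
  then show ?case using vars_mult[of p "p ^ k"] by auto
qed simp

lemma poly_subst_ring_hom:
  fixes f :: "'v \<Rightarrow> ('w, 'k::comm_ring_1) mpoly"
  assumes "\<And>v. v \<in> V \<Longrightarrow> f v \<in> carrier (poly_ring W)"
  shows "poly_subst f \<in> ring_hom (poly_ring V) (poly_ring W)"
proof (rule ring_hom_memI)
  fix p :: "('v, 'k) mpoly" assume "p \<in> carrier (poly_ring V)"
  then have p: "vars p \<subseteq> V" by (simp add: poly_ring_def)
  have "vars (const (Poly_Mapping.lookup p t) * monom_subst f t) \<subseteq> W"
    if "t \<in> Poly_Mapping.keys p" for t
  proof -
    have "vars (monom_subst f t) \<subseteq> W"
      unfolding monom_subst_def
      by (intro vars_prod vars_power) (use p that assms in \<open>auto simp: vars_def poly_ring_def\<close>)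
    then show ?thesis
      using vars_mult[of "const (Poly_Mapping.lookup p t)" "monom_subst f t"] by auto
  qed
  then have "vars (poly_subst f p) \<subseteq> W"
    unfolding poly_subst_def by (rule vars_sum)
  then show "poly_subst f p \<in> carrier (poly_ring W)" by (simp add: poly_ring_def)
qed (simp_all add: poly_ring_def poly_subst_add poly_subst_mult)


section \<open>Ideals of a commutative ring\<close>

text \<open>In the following definitions \<open>R\<close> is a commutative ring and \<open>J\<close> an ideal of \<open>R\<close>.
  The library's monoid \<open>ideals_set R\<close> of ideals provides the powers of \<open>J\<close>.\<close>

abbreviation ideal_pow :: "('a, 'b) ring_scheme \<Rightarrow> 'a set \<Rightarrow> nat \<Rightarrow> 'a set"
  where "ideal_pow R J r \<equiv> J [^]\<^bsub>ideals_set R\<^esub> r"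

definition minimal_generating_set :: "('a, 'b) ring_scheme \<Rightarrow> 'a set \<Rightarrow> 'a set \<Rightarrow> bool"
  where "minimal_generating_set R G J \<longleftrightarrow>
    G \<subseteq> carrier R \<and> Idl\<^bsub>R\<^esub> G = J \<and> (\<forall>H. H \<subset> G \<longrightarrow> Idl\<^bsub>R\<^esub> H \<noteq> J)"

text \<open>\<open>x\<close> is integral over \<open>J\<close> if it satisfies an equation
  \<open>x\<^sup>d + a\<^sub>1 x\<^bsup>d-1\<^esup> + \<dots> + a\<^sub>d = 0\<close> with \<open>d \<ge> 1\<close> and \<open>a\<^sub>i \<in> J\<^sup>i\<close>.\<close>

definition integral_closure :: "('a, 'b) ring_scheme \<Rightarrow> 'a set \<Rightarrow> 'a set"
  where "integral_closure R J = {x \<in> carrier R. \<exists>d a. d \<ge> (1::nat) \<and>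
    (\<forall>i\<in>{1..d}. a i \<in> ideal_pow R J i) \<and>
    x [^]\<^bsub>R\<^esub> d \<oplus>\<^bsub>R\<^esub> (\<Oplus>\<^bsub>R\<^esub>i\<in>{1..d}. a i \<otimes>\<^bsub>R\<^esub> x [^]\<^bsub>R\<^esub> (d - i)) = \<zero>\<^bsub>R\<^esub>}"

definition minimal_primes :: "('a, 'b) ring_scheme \<Rightarrow> 'a set \<Rightarrow> 'a set set"
  where "minimal_primes R J = {P. primeideal P R \<and> J \<subseteq> P \<and>
    (\<forall>Q. primeideal Q R \<and> J \<subseteq> Q \<and> Q \<subseteq> P \<longrightarrow> Q = P)}"

text \<open>The localization at a prime \<open>P\<close> consists of the classes \<open>a/s\<close> with \<open>s \<notin> P\<close>, where
  \<open>a/s = b/t\<close> iff \<open>u(at - bs) = 0\<close> for some \<open>u \<notin> P\<close>.\<close>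

definition loc_rel :: "('a, 'b) ring_scheme \<Rightarrow> 'a set \<Rightarrow> (('a \<times> 'a) \<times> ('a \<times> 'a)) set"
  where "loc_rel R P = {((a, s), (b, t)).
    a \<in> carrier R \<and> s \<in> carrier R - P \<and> b \<in> carrier R \<and> t \<in> carrier R - P \<and>
    (\<exists>u\<in>carrier R - P. u \<otimes>\<^bsub>R\<^esub> (a \<otimes>\<^bsub>R\<^esub> t \<ominus>\<^bsub>R\<^esub> b \<otimes>\<^bsub>R\<^esub> s) = \<zero>\<^bsub>R\<^esub>)}"

definition loc_frac :: "('a, 'b) ring_scheme \<Rightarrow> 'a set \<Rightarrow> 'a \<Rightarrow> 'a \<Rightarrow> ('a \<times> 'a) set"
  where "loc_frac R P a s = loc_rel R P `` {(a, s)}"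

text \<open>The extension \<open>J R\<^sub>P\<close>, i.e. all fractions with numerator in \<open>J\<close>, and the
  contraction \<open>K \<inter> R\<close> of a subset \<open>K\<close> of \<open>R\<^sub>P\<close> along \<open>x \<mapsto> x/1\<close>.\<close>

definition loc_extension :: "('a, 'b) ring_scheme \<Rightarrow> 'a set \<Rightarrow> 'a set \<Rightarrow> ('a \<times> 'a) set set"
  where "loc_extension R P J = {loc_frac R P a s | a s. a \<in> J \<and> s \<in> carrier R - P}"

definition loc_contraction :: "('a, 'b) ring_scheme \<Rightarrow> 'a set \<Rightarrow> ('a \<times> 'a) set set \<Rightarrow> 'a set"
  where "loc_contraction R P K = {x \<in> carrier R. loc_frac R P x \<one>\<^bsub>R\<^esub> \<in> K}"

text \<open>Intersecting with \<open>carrier R\<close> makes the empty intersection (\<open>J = R\<close>) equal to \<open>R\<close>.\<close>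

definition symbolic_power :: "('a, 'b) ring_scheme \<Rightarrow> 'a set \<Rightarrow> nat \<Rightarrow> 'a set"
  where "symbolic_power R J r = carrier R \<inter>
    (\<Inter>P\<in>minimal_primes R J. loc_contraction R P (loc_extension R P (ideal_pow R J r)))"


section \<open>Extremal ideals\<close>

definition extremal_ring :: "nat \<Rightarrow> (nat set, 'k::field) mpoly ring"
  where "extremal_ring q = poly_ring {A. A \<noteq> {} \<and> A \<subseteq> {1..q}}"

definition extremal_gen :: "nat \<Rightarrow> nat \<Rightarrow> (nat set, 'k::field) mpoly"
  where "extremal_gen q i = (\<Prod>A\<in>{A. A \<subseteq> {1..q} \<and> i \<in> A}. var A)"

definition extremal_ideal :: "nat \<Rightarrow> (nat set, 'k::field) mpoly set"
  where "extremal_ideal q = Idl\<^bsub>extremal_ring q\<^esub> (extremal_gen q ` {1..q})"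

definition psi_var ::
    "nat \<Rightarrow> nat \<Rightarrow> (nat \<Rightarrow> (nat, 'k) mpoly) \<Rightarrow> nat set \<Rightarrow> (nat, 'k::field) mpoly"
  where "psi_var n q m A =
    (\<Prod>k\<in>{k\<in>{1..n}. \<forall>j\<in>{1..q}. var k divides\<^bsub>poly_ring {1..n}\<^esub> m j \<longleftrightarrow> j \<in> A}. var k)"

definition psi ::
    "nat \<Rightarrow> nat \<Rightarrow> (nat \<Rightarrow> (nat, 'k) mpoly) \<Rightarrow> (nat set, 'k) mpoly \<Rightarrow> (nat, 'k::field) mpoly"
  where "psi n q m = poly_subst (psi_var n q m)"

lemma psi_ring_hom: "psi n q m \<in> ring_hom (extremal_ring q) (poly_ring {1..n})"
  unfolding psi_def extremal_ring_def
proof (rule poly_subst_ring_hom)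
  fix A
  have "vars (psi_var n q m A) \<subseteq> {1..n}"
    unfolding psi_var_def by (rule vars_prod) auto
  then show "psi_var n q m A \<in> carrier (poly_ring {1..n})" by (simp add: poly_ring_def)
qed

end

theory Submission
  imports Defs "Jordan_Normal_Form.Char_Poly"
begin

text \<open>All ideals involved are monomial ideals, so each of them is described by a set of exponents, and
the theorem becomes a statement about exponents. Let \<open>g\<^sub>1, \<dots>, g\<^sub>q\<close> be the exponents of the
generators of \<open>I\<close>. For a variable \<open>x\<^sub>k\<close> let its support be the set of all \<open>j\<close> such that
\<open>x\<^sub>k\<close> divides the \<open>j\<close>-th generator. The map \<open>\<psi>\<close> sends the monomial with exponent \<open>t\<close> to the
monomial whose \<open>k\<close>-th exponent is the value of \<open>t\<close> at the support of \<open>k\<close>; this additive and monotone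
map on exponents is called \<open>pullback\<close>, and it maps the exponent of \<open>\<epsilon>\<^sub>j\<close> to \<open>g\<^sub>j\<close>. By
\<open>genideal_subst_monomial_ideal\<close> it remains to show, for the exponent sets that describe
the integral closures and the symbolic powers, that \<open>pullback\<close> maps the set of the extremal ideal
into the set of \<open>I\<close>, and that every element of the latter lies above the image of an element of
the former.

The integral closure of a monomial ideal is spanned by the monomials whose exponents lie in the
Newton polyhedron of the generators (\<open>integral_closure_monomial_ideal\<close>). That an integral
polynomial has its exponents there is shown by looking at a vertex of the Newton polyhedron of the
polynomial and the generators: if a vertex \<open>b\<close> came from the polynomial \<open>f\<close> alone, the term with exponent
\<open>d b\<close> in \<open>f\<^sup>d\<close> could not be cancelled by the remaining terms of an equation of integral
dependence. The converse is the determinant trick, applied to a matrix indexed by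
monomials. Symbolic powers of a square-free monomial ideal are described by vertex covers
(\<open>symbolic_power_monomial_ideal\<close>): the minimal primes are generated by the variables in a minimal
vertex cover \<open>C\<close>, and membership in the contracted power says that every
exponent has total degree at least \<open>r\<close> on \<open>C\<close>.

Both liftings then have explicit solutions. If \<open>N a\<close> dominates a sum of \<open>N r\<close> generators
in which \<open>g\<^sub>j\<close> occurs \<open>c\<^sub>j\<close> times, then the exponent of \<open>y\<^sub>A\<close> is chosen as \<open>(\<Sum>j\<in>A. c\<^sub>j) / N\<close>, rounded
up (\<open>newton_lift\<close>). If \<open>a\<close> satisfies the cover inequalities, then the exponent of \<open>y\<^sub>A\<close> is chosen as the
minimum of \<open>a\<^sub>k\<close> over all \<open>k\<close> with support \<open>A\<close>, and as \<open>r\<close> when there is no such \<open>k\<close>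
(\<open>cover_exponents_lift\<close>).\<close>

section \<open>Monomials and products of polynomials\<close>

definition exp_le :: "('v \<Rightarrow>\<^sub>0 nat) \<Rightarrow> ('v \<Rightarrow>\<^sub>0 nat) \<Rightarrow> bool"  (infix "\<preceq>" 50)
  where "s \<preceq> t \<longleftrightarrow> (\<forall>v. Poly_Mapping.lookup s v \<le> Poly_Mapping.lookup t v)"

abbreviation monomial :: "('v \<Rightarrow>\<^sub>0 nat) \<Rightarrow> ('v, 'k::comm_ring_1) mpoly"
  where "monomial t \<equiv> Poly_Mapping.single t 1"

lemma exp_le_refl [simp]: "t \<preceq> t"
  by (simp add: exp_le_def)

lemma exp_le_trans: "s \<preceq> t \<Longrightarrow> t \<preceq> u \<Longrightarrow> s \<preceq> u"
  unfolding exp_le_def using le_trans by blast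

lemma exp_le_add [simp]: "s \<preceq> s + t" "t \<preceq> s + t"
  by (simp_all add: exp_le_def lookup_add)

lemma exp_le_diff_add: "s \<preceq> t \<Longrightarrow> (t - s) + s = t"
  by (rule poly_mapping_eqI) (simp add: exp_le_def lookup_add lookup_minus)

lemma exp_le_add_mono: "s \<preceq> t \<Longrightarrow> s' \<preceq> t' \<Longrightarrow> s + s' \<preceq> t + t'"
  by (simp add: exp_le_def lookup_add add_mono)

lemma keys_mono: "s \<preceq> t \<Longrightarrow> Poly_Mapping.keys s \<subseteq> Poly_Mapping.keys t"
  unfolding exp_le_def by (metis in_keys_iff le_zero_eq subsetI)

lemma keys_add_nat: "Poly_Mapping.keys (s + t) = Poly_Mapping.keys s \<union> Poly_Mapping.keys (t :: 'v \<Rightarrow>\<^sub>0 nat)"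
  by (auto simp: in_keys_iff lookup_add)



lemma keys_sum_mset_subset:
  fixes M :: "('v \<Rightarrow>\<^sub>0 nat) multiset"
  shows "(\<And>t. t \<in># M \<Longrightarrow> Poly_Mapping.keys t \<subseteq> V) \<Longrightarrow> Poly_Mapping.keys (\<Sum>\<^sub># M) \<subseteq> V"
  by (induction M) (auto simp: keys_add_nat)

text \<open>An exponent that decomposes in only one way as a sum of exponents of the factors cannot suffer
cancellation. Every non-vanishing of a coefficient below is obtained in this way.\<close>

lemma lookup_mult_unique:
  fixes p q :: "('v, 'k::comm_ring_1) mpoly"
  assumes "\<And>s t. s \<in> Poly_Mapping.keys p \<Longrightarrow> t \<in> Poly_Mapping.keys q \<Longrightarrow>
    s + t = a + b \<Longrightarrow> s = a \<and> t = b"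
  shows "Poly_Mapping.lookup (p * q) (a + b) = Poly_Mapping.lookup p a * Poly_Mapping.lookup q b"
proof -
  let ?P = "Poly_Mapping.keys p" and ?Q = "Poly_Mapping.keys q"
  have "p * q = (\<Sum>s\<in>?P. \<Sum>t\<in>?Q.
      Poly_Mapping.single (s + t) (Poly_Mapping.lookup p s * Poly_Mapping.lookup q t))"
    by (subst mpoly_as_sum[of p], subst mpoly_as_sum[of q])
       (simp add: sum_product mult_single)
  then have "Poly_Mapping.lookup (p * q) (a + b) =
      (\<Sum>s\<in>?P. \<Sum>t\<in>?Q. Poly_Mapping.lookup p s * Poly_Mapping.lookup q t when s + t = a + b)"
    by (simp add: lookup_sum lookup_single)
  also have "\<dots> = (\<Sum>s\<in>?P. \<Sum>t\<in>?Q.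
      if t = b then (if s = a then Poly_Mapping.lookup p a * Poly_Mapping.lookup q b else 0) else 0)"
    using assms by (intro sum.cong refl) (auto simp: when_def)
  also have "\<dots> = Poly_Mapping.lookup p a * Poly_Mapping.lookup q b"
    by (cases "Poly_Mapping.lookup q b = 0"; cases "Poly_Mapping.lookup p a = 0")
      (simp_all add: sum.delta in_keys_iff)
  finally show ?thesis .
qed

text \<open>Minimise one coordinate after the other in both sets: a sum of two minimal elements only arises
from minimal elements. This does the work of comparing leading terms for variables that carry no
linear order, such as the sets of indices of the extremal ring.\<close>

lemma unique_sum_exists:
  fixes A B :: "('v \<Rightarrow>\<^sub>0 nat) set"
  assumes "finite V" "finite A" "finite B" "A \<noteq> {}" "B \<noteq> {}"
    and "\<And>a a' v. a \<in> A \<Longrightarrow> a' \<in> A \<Longrightarrow> v \<notin> V \<Longrightarrow> Poly_Mapping.lookup a v = Poly_Mapping.lookup a' v"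
    and "\<And>b b' v. b \<in> B \<Longrightarrow> b' \<in> B \<Longrightarrow> v \<notin> V \<Longrightarrow> Poly_Mapping.lookup b v = Poly_Mapping.lookup b' v"
  shows "\<exists>a\<in>A. \<exists>b\<in>B. \<forall>a'\<in>A. \<forall>b'\<in>B. a' + b' = a + b \<longrightarrow> a' = a \<and> b' = b"
  using assms
proof (induction V arbitrary: A B rule: finite_induct)
  case empty
  then show ?case by (metis empty_iff equals0I poly_mapping_eqI)
next
  case (insert v V)
  let ?m = "\<lambda>A. Min ((\<lambda>a. Poly_Mapping.lookup a v) ` A)"
  \<comment> \<open>The minimal elements agree in the coordinate \<open>v\<close>, as the induction hypothesis requires.\<close>
  let ?A = "{a \<in> A. Poly_Mapping.lookup a v = ?m A}"
  let ?B = "{b \<in> B. Poly_Mapping.lookup b v = ?m B}"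
  have min: "?m A \<le> Poly_Mapping.lookup a v" if "a \<in> A" for a
    using that insert.prems by simp
  have min': "?m B \<le> Poly_Mapping.lookup b v" if "b \<in> B" for b
    using that insert.prems by simp
  have "?m A \<in> (\<lambda>a. Poly_Mapping.lookup a v) ` A" "?m B \<in> (\<lambda>a. Poly_Mapping.lookup a v) ` B"
    using insert.prems by (auto intro!: Min_in)
  then have ne: "?A \<noteq> {}" "?B \<noteq> {}"
    by (auto simp: image_iff intro: sym)
  have "\<exists>a\<in>?A. \<exists>b\<in>?B. \<forall>a'\<in>?A. \<forall>b'\<in>?B. a' + b' = a + b \<longrightarrow> a' = a \<and> b' = b"
  proof (rule insert.IH)
    fix a a' w assume *: "a \<in> ?A" "a' \<in> ?A" "w \<notin> V"
    then show "Poly_Mapping.lookup a w = Poly_Mapping.lookup a' w"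
      using insert.prems(5)[of a a' w] by (cases "w = v") auto
  next
    fix b b' w assume *: "b \<in> ?B" "b' \<in> ?B" "w \<notin> V"
    then show "Poly_Mapping.lookup b w = Poly_Mapping.lookup b' w"
      using insert.prems(6)[of b b' w] by (cases "w = v") auto
  qed (use insert.prems ne in auto)
  then obtain a b where ab: "a \<in> ?A" "b \<in> ?B"
    "\<And>a' b'. a' \<in> ?A \<Longrightarrow> b' \<in> ?B \<Longrightarrow> a' + b' = a + b \<Longrightarrow> a' = a \<and> b' = b"
    by blast
  have "a' = a \<and> b' = b" if h: "a' \<in> A" "b' \<in> B" "a' + b' = a + b" for a' b'
  proof -
    have "Poly_Mapping.lookup a' v + Poly_Mapping.lookup b' v
        = Poly_Mapping.lookup a v + Poly_Mapping.lookup b v"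
      using h(3) by (metis lookup_add)
    then have "a' \<in> ?A" "b' \<in> ?B"
      using ab(1,2) min[OF h(1)] min'[OF h(2)] h(1,2) by auto
    then show ?thesis using ab(3) h(3) by blast
  qed
  then show ?case using ab(1,2) by blast
qed

text \<open>The parts of least weight of two non-zero polynomials have a non-zero product, i.e.\ the least
weight is a valuation. With weight \<open>0\<close> this says that there are no zero divisors; with the total degree
in a set of variables it gives the primality of ideals generated by variables and the behaviour of
their powers under localization.\<close>

lemma min_weight_term_mult:
  fixes p q :: "('v, 'k::idom) mpoly" and w :: "('v \<Rightarrow>\<^sub>0 nat) \<Rightarrow> nat"
  assumes add: "\<And>s t. w (s + t) = w s + w t" and "p \<noteq> 0" "q \<noteq> 0"
  obtains a b where "a \<in> Poly_Mapping.keys p" "b \<in> Poly_Mapping.keys q"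
    "\<And>s. s \<in> Poly_Mapping.keys p \<Longrightarrow> w a \<le> w s" "\<And>t. t \<in> Poly_Mapping.keys q \<Longrightarrow> w b \<le> w t"
    "a + b \<in> Poly_Mapping.keys (p * q)"
proof -
  let ?low = "\<lambda>p :: ('v, 'k) mpoly. {a \<in> Poly_Mapping.keys p. \<forall>s\<in>Poly_Mapping.keys p. w a \<le> w s}"
  let ?V = "\<Union> (Poly_Mapping.keys ` (Poly_Mapping.keys p \<union> Poly_Mapping.keys q))"
  have low: "?low p' \<noteq> {}" if "p' \<noteq> 0" for p'
  proof -
    have "Poly_Mapping.keys p' \<noteq> {}" using that by (metis keys_eq_empty)
    then obtain x where "is_arg_min w (\<lambda>x. x \<in> Poly_Mapping.keys p') x"
      using ex_is_arg_min_if_finite[of "Poly_Mapping.keys p'" w] by auto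
    then show ?thesis by (auto simp: is_arg_min_linorder)
  qed
  have "\<exists>a\<in>?low p. \<exists>b\<in>?low q. \<forall>a'\<in>?low p. \<forall>b'\<in>?low q. a' + b' = a + b \<longrightarrow> a' = a \<and> b' = b"
  proof (rule unique_sum_exists[of ?V])
    show "?low p \<noteq> {}" "?low q \<noteq> {}" using low assms by blast+
  next
    fix a a' v assume "a \<in> ?low p" "a' \<in> ?low p" "v \<notin> ?V"
    then show "Poly_Mapping.lookup a v = Poly_Mapping.lookup a' v"
      by (auto simp: in_keys_iff)
  next
    fix b b' v assume "b \<in> ?low q" "b' \<in> ?low q" "v \<notin> ?V"
    then show "Poly_Mapping.lookup b v = Poly_Mapping.lookup b' v"
      by (auto simp: in_keys_iff)
  qed auto
  then obtain a b where ab: "a \<in> ?low p" "b \<in> ?low q"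
    and uniq: "\<And>a' b'. a' \<in> ?low p \<Longrightarrow> b' \<in> ?low q \<Longrightarrow> a' + b' = a + b \<Longrightarrow> a' = a \<and> b' = b"
    by blast
  have "Poly_Mapping.lookup (p * q) (a + b) = Poly_Mapping.lookup p a * Poly_Mapping.lookup q b"
  proof (rule lookup_mult_unique)
    fix s t assume st: "s \<in> Poly_Mapping.keys p" "t \<in> Poly_Mapping.keys q" "s + t = a + b"
    have "w s + w t = w a + w b" using st(3) add by metis
    moreover have "w a \<le> w s" "w b \<le> w t" using ab st by auto
    ultimately have "w s = w a" "w t = w b" by auto
    then have "s \<in> ?low p" "t \<in> ?low q" using ab st by auto
    then show "s = a \<and> t = b" using uniq st(3) by blast
  qed
  also have "\<dots> \<noteq> 0" using ab by (auto simp: in_keys_iff)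
  finally show thesis using ab by (intro that[of a b]) (auto simp: in_keys_iff)
qed

lemma mpoly_no_zero_divisors:
  fixes p q :: "('v, 'k::idom) mpoly"
  assumes "p \<noteq> 0" "q \<noteq> 0" shows "p * q \<noteq> 0"
  using min_weight_term_mult[of "\<lambda>_. 0" p q] assms by fastforce

section \<open>Monomial ideals\<close>

lemma poly_ring_simps [simp]:
  "carrier (poly_ring V) = {p. vars p \<subseteq> V}" "monoid.mult (poly_ring V) = (*)"
  "one (poly_ring V) = 1" "zero (poly_ring V) = 0" "add (poly_ring V) = (+)"
  by (simp_all add: poly_ring_def)

lemma vars_subset_iff: "vars p \<subseteq> V \<longleftrightarrow> (\<forall>t\<in>Poly_Mapping.keys p. Poly_Mapping.keys t \<subseteq> V)"
  by (auto simp: vars_def)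

lemma nat_pow_poly_ring [simp]: "p [^]\<^bsub>poly_ring V\<^esub> (d::nat) = p ^ d"
  by (induction d) (simp_all add: nat_pow_def mult.commute)

lemma finsum_poly_ring:
  assumes "\<And>i. i \<in> A \<Longrightarrow> vars (h i) \<subseteq> V"
  shows "finsum (poly_ring V) h A = sum h A"
proof -
  interpret cring "poly_ring V" by (rule cring_poly_ring)
  show ?thesis using assms
  proof (induction A rule: infinite_finite_induct)
    case (insert a A)
    then show ?case by (subst finsum_insert) auto
  qed (simp_all add: finsum_infinite)
qed

lemma minus_poly_ring:
  assumes "vars a \<subseteq> V" "vars b \<subseteq> V"
  shows "a \<ominus>\<^bsub>poly_ring V\<^esub> b = a - b"
proof -
  interpret cring "poly_ring V" by (rule cring_poly_ring)
  have "\<ominus>\<^bsub>poly_ring V\<^esub> b = - b" by (rule minus_equality) (use assms in auto)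
  then show ?thesis by (simp add: a_minus_def)
qed

definition monomial_ideal :: "'v set \<Rightarrow> ('v \<Rightarrow>\<^sub>0 nat) set \<Rightarrow> ('v, 'k::comm_ring_1) mpoly set"
  where "monomial_ideal V E =
    {p. \<forall>t\<in>Poly_Mapping.keys p. Poly_Mapping.keys t \<subseteq> V \<and> (\<exists>e\<in>E. e \<preceq> t)}"

lemma monomial_idealI:
  "(\<And>t. t \<in> Poly_Mapping.keys p \<Longrightarrow> Poly_Mapping.keys t \<subseteq> V \<and> (\<exists>e\<in>E. e \<preceq> t)) \<Longrightarrow> p \<in> monomial_ideal V E"
  by (simp add: monomial_ideal_def)

lemma monomial_ideal_vars: "p \<in> monomial_ideal V E \<Longrightarrow> vars p \<subseteq> V"
  by (auto simp: monomial_ideal_def vars_def)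

lemma mem_monomial_ideal_upward_closed:
  assumes "\<And>b c. b \<in> E \<Longrightarrow> b \<preceq> c \<Longrightarrow> c \<in> E"
  shows "p \<in> monomial_ideal V E \<longleftrightarrow> vars p \<subseteq> V \<and> Poly_Mapping.keys p \<subseteq> E"
  using assms exp_le_refl unfolding monomial_ideal_def vars_subset_iff by blast

lemma monomial_mem_monomial_ideal:
  "e \<in> E \<Longrightarrow> Poly_Mapping.keys e \<subseteq> V \<Longrightarrow> monomial e \<in> monomial_ideal V E"
  by (auto simp: monomial_ideal_def intro!: bexI[of _ e])

lemma monomial_ideal_zero [simp]: "0 \<in> monomial_ideal V E"
  by (simp add: monomial_ideal_def)

lemma monomial_ideal_add:
  "p \<in> monomial_ideal V E \<Longrightarrow> q \<in> monomial_ideal V E \<Longrightarrow> p + q \<in> monomial_ideal V E"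
  using keys_add[of p q] by (fastforce simp: monomial_ideal_def)

lemma monomial_ideal_uminus: "p \<in> monomial_ideal V E \<Longrightarrow> - p \<in> monomial_ideal V E"
  by (simp add: monomial_ideal_def)

lemma monomial_ideal_sum:
  "(\<And>i. i \<in> A \<Longrightarrow> h i \<in> monomial_ideal V E) \<Longrightarrow> sum h A \<in> monomial_ideal V E"
  by (induction A rule: infinite_finite_induct) (simp_all add: monomial_ideal_add)

lemma monomial_ideal_mult:
  assumes "p \<in> monomial_ideal V E" "q \<in> monomial_ideal V F"
    and "\<And>e f. e \<in> E \<Longrightarrow> f \<in> F \<Longrightarrow> \<exists>g\<in>G. g \<preceq> e + f"
  shows "p * q \<in> monomial_ideal V G"
proof (rule monomial_idealI)
  fix u assume "u \<in> Poly_Mapping.keys (p * q)"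
  then obtain s t where st: "u = s + t" "s \<in> Poly_Mapping.keys p" "t \<in> Poly_Mapping.keys q"
    using keys_mult by blast
  obtain e f where ef: "e \<in> E" "e \<preceq> s" "f \<in> F" "f \<preceq> t"
    using assms(1,2) st(2,3) unfolding monomial_ideal_def by blast
  obtain g where "g \<in> G" "g \<preceq> e + f" using assms(3) ef by blast
  then have "\<exists>g\<in>G. g \<preceq> u" using ef st(1) exp_le_trans exp_le_add_mono by metis
  moreover have "Poly_Mapping.keys u \<subseteq> V"
    using assms(1,2) st by (auto simp: monomial_ideal_def keys_add_nat)
  ultimately show "Poly_Mapping.keys u \<subseteq> V \<and> (\<exists>g\<in>G. g \<preceq> u)" by blast
qed

lemma monomial_ideal_mult_left:
  assumes "vars p \<subseteq> V" "q \<in> monomial_ideal V E"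
  shows "p * q \<in> monomial_ideal V E"
proof (rule monomial_ideal_mult)
  show "p \<in> monomial_ideal V {0}"
    using assms(1) by (auto simp: monomial_ideal_def vars_def exp_le_def)
  fix e f assume "e \<in> {0 :: 'a \<Rightarrow>\<^sub>0 nat}" "f \<in> E"
  then show "\<exists>g\<in>E. g \<preceq> e + f" by (intro bexI[of _ f]) auto
qed (use assms in auto)

lemma ideal_monomial_ideal:
  "ideal (monomial_ideal V E :: ('v, 'k::comm_ring_1) mpoly set) (poly_ring V)"
proof -
  interpret cring "poly_ring V :: ('v, 'k) mpoly ring" by (rule cring_poly_ring)
  have min: "\<ominus>\<^bsub>poly_ring V\<^esub> p = - p" if "vars p \<subseteq> V" for p :: "('v, 'k) mpoly"
    by (rule minus_equality) (use that in auto)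
  show ?thesis
  proof (rule idealI)
    show "subgroup (monomial_ideal V E) (add_monoid (poly_ring V :: ('v, 'k) mpoly ring))"
      by (rule add.subgroupI)
         (auto simp: min monomial_ideal_vars monomial_ideal_add monomial_ideal_uminus simp flip: a_inv_def
           intro: monomial_ideal_zero dest: subsetD[OF monomial_ideal_vars])
  next
    fix p x :: "('v, 'k) mpoly"
    assume px: "p \<in> monomial_ideal V E" "x \<in> carrier (poly_ring V)"
    then show "x \<otimes>\<^bsub>poly_ring V\<^esub> p \<in> monomial_ideal V E" by (simp add: monomial_ideal_mult_left)
    then show "p \<otimes>\<^bsub>poly_ring V\<^esub> x \<in> monomial_ideal V E" by (simp add: mult.commute)
  qed (rule ring_axioms)
qed

lemma ideal_poly_ring_sum:
  assumes "ideal J (poly_ring V)" "\<And>i. i \<in> A \<Longrightarrow> h i \<in> J"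
  shows "sum h A \<in> J"
proof -
  interpret ideal J "poly_ring V" by fact
  have "0 \<in> J" "\<And>x y. x \<in> J \<Longrightarrow> y \<in> J \<Longrightarrow> x + y \<in> J"
    using additive_subgroup.zero_closed[OF is_additive_subgroup]
      additive_subgroup.a_closed[OF is_additive_subgroup] by auto
  then show ?thesis using assms(2)
    by (induction A rule: infinite_finite_induct) auto
qed

text \<open>An ideal that contains a polynomial's monomials contains the polynomial, so monomial ideals can be
compared with arbitrary ideals on monomials.\<close>

lemma monomial_ideal_minimal:
  assumes J: "ideal J (poly_ring V)" and "\<And>e. e \<in> E \<Longrightarrow> monomial e \<in> J"
  shows "(monomial_ideal V E :: ('v, 'k::comm_ring_1) mpoly set) \<subseteq> J"
proof
  fix p :: "('v, 'k) mpoly" assume p: "p \<in> monomial_ideal V E"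
  interpret ideal J "poly_ring V" by fact
  have "Poly_Mapping.single t (Poly_Mapping.lookup p t) \<in> J" if t: "t \<in> Poly_Mapping.keys p" for t
  proof -
    obtain e where e: "e \<in> E" "e \<preceq> t" "Poly_Mapping.keys t \<subseteq> V"
      using p t by (auto simp: monomial_ideal_def)
    have "t - e \<preceq> t" using exp_le_diff_add[OF e(2)] exp_le_add(1)[of "t - e" e] by simp
    then have "vars (Poly_Mapping.single (t - e) (Poly_Mapping.lookup p t)) \<subseteq> V"
      using keys_mono[of "t - e" t] e(3) by (auto simp: vars_def)
    then have "Poly_Mapping.single (t - e) (Poly_Mapping.lookup p t) * monomial e \<in> J"
      using I_l_closed[OF assms(2)[OF e(1)]] by simp
    then show ?thesis by (simp add: mult_single exp_le_diff_add[OF e(2)])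
  qed
  then have "(\<Sum>t\<in>Poly_Mapping.keys p. Poly_Mapping.single t (Poly_Mapping.lookup p t)) \<in> J"
    by (rule ideal_poly_ring_sum[OF J])
  then show "p \<in> J" using mpoly_as_sum[of p] by simp
qed

lemma genideal_eq_monomial_ideal:
  assumes "X \<subseteq> monomial_ideal V E" "\<And>e. e \<in> E \<Longrightarrow> monomial e \<in> X"
  shows "Idl\<^bsub>poly_ring V\<^esub> X = (monomial_ideal V E :: ('v, 'k::comm_ring_1) mpoly set)"
proof
  interpret cring "poly_ring V :: ('v, 'k) mpoly ring" by (rule cring_poly_ring)
  have X: "X \<subseteq> carrier (poly_ring V)"
    using assms(1) monomial_ideal_vars by fastforce
  show "Idl\<^bsub>poly_ring V\<^esub> X \<subseteq> monomial_ideal V E"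
    by (rule genideal_minimal[OF ideal_monomial_ideal assms(1)])
  show "monomial_ideal V E \<subseteq> Idl\<^bsub>poly_ring V\<^esub> X"
    by (rule monomial_ideal_minimal[OF genideal_ideal[OF X]]) (use assms(2) genideal_self[OF X] in blast)
qed

definition sums_of :: "nat \<Rightarrow> ('v \<Rightarrow>\<^sub>0 nat) set \<Rightarrow> ('v \<Rightarrow>\<^sub>0 nat) set"
  where "sums_of r G = {\<Sum>\<^sub># M | M. set_mset M \<subseteq> G \<and> size M = r}"

lemma sums_of_0 [simp]: "sums_of 0 G = {0}"
  by (auto simp: sums_of_def)

lemma sums_of_add:
  assumes "s \<in> sums_of i G" "t \<in> sums_of j G" shows "s + t \<in> sums_of (i + j) G"
proof -
  obtain M N where "s = \<Sum>\<^sub># M" "t = \<Sum>\<^sub># N" "set_mset M \<subseteq> G" "set_mset N \<subseteq> G" "size M = i" "size N = j"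
    using assms by (auto simp: sums_of_def)
  then have "s + t = \<Sum>\<^sub># (M + N) \<and> set_mset (M + N) \<subseteq> G \<and> size (M + N) = i + j" by simp
  then show ?thesis unfolding sums_of_def by blast
qed

lemma sums_of_1: "g \<in> G \<Longrightarrow> g \<in> sums_of 1 G"
  unfolding sums_of_def by (rule CollectI, rule exI[of _ "{#g#}"]) auto

lemma sums_of_Suc: "sums_of (Suc r) G = {s + g | s g. s \<in> sums_of r G \<and> g \<in> G}"
proof
  show "sums_of (Suc r) G \<subseteq> {s + g | s g. s \<in> sums_of r G \<and> g \<in> G}"
  proof
    fix t assume "t \<in> sums_of (Suc r) G"
    then obtain M where M: "t = \<Sum>\<^sub># M" "set_mset M \<subseteq> G" "size M = Suc r" by (auto simp: sums_of_def)
    obtain g N where "M = add_mset g N" using M(3) by (cases M) auto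
    then have "t = \<Sum>\<^sub># N + g" "g \<in> G" "\<Sum>\<^sub># N \<in> sums_of r G"
      using M by (auto simp: add.commute sums_of_def)
    then show "t \<in> {s + g | s g. s \<in> sums_of r G \<and> g \<in> G}" by blast
  qed
  show "{s + g | s g. s \<in> sums_of r G \<and> g \<in> G} \<subseteq> sums_of (Suc r) G"
    using sums_of_add[OF _ sums_of_1] by auto
qed

lemma finite_sums_of: "finite G \<Longrightarrow> finite (sums_of r G)"
  by (induction r) (auto simp: sums_of_Suc finite_image_set2)

lemma keys_sums_of:
  "t \<in> sums_of r G \<Longrightarrow> (\<And>g. g \<in> G \<Longrightarrow> Poly_Mapping.keys g \<subseteq> V) \<Longrightarrow> Poly_Mapping.keys t \<subseteq> V"
  by (auto simp: sums_of_def intro!: keys_sum_mset_subset del: subsetI)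

lemma ideal_prod_monomial_ideal:
  assumes "\<And>e. e \<in> E \<Longrightarrow> Poly_Mapping.keys e \<subseteq> V" "\<And>e. e \<in> F \<Longrightarrow> Poly_Mapping.keys e \<subseteq> V"
  shows "ideal_prod (poly_ring V) (monomial_ideal V E) (monomial_ideal V F) =
    (monomial_ideal V {e + f | e f. e \<in> E \<and> f \<in> F} :: ('v, 'k::comm_ring_1) mpoly set)"
proof
  interpret cring "poly_ring V :: ('v, 'k) mpoly ring" by (rule cring_poly_ring)
  let ?G = "{e + f | e f. e \<in> E \<and> f \<in> F}"
  let ?P = "ideal_prod (poly_ring V) (monomial_ideal V E) (monomial_ideal V F) :: ('v, 'k) mpoly set"
  show "?P \<subseteq> monomial_ideal V ?G"
  proof
    fix p assume "p \<in> ?P"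
    then show "p \<in> monomial_ideal V ?G"
    proof (induction rule: ideal_prod.induct)
      case (prod p q)
      have "p * q \<in> monomial_ideal V ?G"
        by (rule monomial_ideal_mult[OF prod]) (use exp_le_refl in blast)
      then show ?case by simp
    qed (simp add: monomial_ideal_add)
  qed

  show "monomial_ideal V ?G \<subseteq> ?P"
  proof (rule monomial_ideal_minimal[OF ideal_prod_is_ideal[OF ideal_monomial_ideal ideal_monomial_ideal]])
    fix g assume "g \<in> ?G"
    then obtain e f where ef: "g = e + f" "e \<in> E" "f \<in> F" by blast
    then have "monomial e \<otimes>\<^bsub>poly_ring V\<^esub> monomial f \<in> ?P"
      using assms by (intro ideal_prod.prod monomial_mem_monomial_ideal) auto
    then show "monomial g \<in> ?P" using ef(1) by (simp add: mult_single)
  qed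
qed

lemma ideal_pow_monomial_ideal:
  assumes "\<And>g. g \<in> G \<Longrightarrow> Poly_Mapping.keys g \<subseteq> V"
  shows "ideal_pow (poly_ring V) (monomial_ideal V G) r =
    (monomial_ideal V (sums_of r G) :: ('v, 'k::comm_ring_1) mpoly set)"
proof (induction r)
  case 0
  have "(monomial_ideal V {0} :: ('v, 'k) mpoly set) = {p. vars p \<subseteq> V}"
    by (auto simp: monomial_ideal_def vars_subset_iff exp_le_def)
  then show ?case by (simp add: nat_pow_def ideals_set_def)
next
  case (Suc r)
  have "ideal_pow (poly_ring V) (monomial_ideal V G) (Suc r) =
    ideal_prod (poly_ring V) (ideal_pow (poly_ring V) (monomial_ideal V G) r)
      (monomial_ideal V G :: ('v, 'k) mpoly set)"
    by (simp add: nat_pow_def ideals_set_def)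
  also have "\<dots> = monomial_ideal V (sums_of (Suc r) G)"
    unfolding Suc.IH sums_of_Suc
    by (rule ideal_prod_monomial_ideal) (use assms keys_sums_of in blast)+
  finally show ?case .
qed

section \<open>Newton polyhedra\<close>

text \<open>Exponents form only an additive monoid, hence the iterated sum.\<close>

definition multiple :: "nat \<Rightarrow> ('v \<Rightarrow>\<^sub>0 nat) \<Rightarrow> ('v \<Rightarrow>\<^sub>0 nat)"  (infixl "\<star>" 70)
  where "n \<star> b = \<Sum>\<^sub># (replicate_mset n b)"

lemma lookup_multiple [simp]: "Poly_Mapping.lookup (n \<star> b) v = n * Poly_Mapping.lookup b v"
  unfolding multiple_def by (induction n) (simp_all add: lookup_add)

lemma multiple_0 [simp]: "0 \<star> b = 0"
  by (simp add: multiple_def)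

lemma multiple_Suc: "Suc n \<star> b = b + n \<star> b"
  by (simp add: multiple_def)

text \<open>The integer points of the Newton polyhedron of \<open>G\<close>, the convex hull of \<open>G\<close> plus the positive
orthant: a rational convex combination below \<open>b\<close>, multiplied by its denominator, is a multiset whose sum
is at most its size times \<open>b\<close>.\<close>

definition newton :: "('v \<Rightarrow>\<^sub>0 nat) set \<Rightarrow> ('v \<Rightarrow>\<^sub>0 nat) set"
  where "newton G = {b. \<exists>M. M \<noteq> {#} \<and> set_mset M \<subseteq> G \<and> \<Sum>\<^sub># M \<preceq> size M \<star> b}"

lemma newtonI:
  "M \<noteq> {#} \<Longrightarrow> set_mset M \<subseteq> G \<Longrightarrow> \<Sum>\<^sub># M \<preceq> size M \<star> b \<Longrightarrow> b \<in> newton G"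
  unfolding newton_def by blast

lemma newtonE:
  assumes "b \<in> newton G"
  obtains M where "M \<noteq> {#}" "set_mset M \<subseteq> G" "\<Sum>\<^sub># M \<preceq> size M \<star> b"
  using assms unfolding newton_def by blast

lemma subset_newton: "G \<subseteq> newton G"
proof
  fix g assume "g \<in> G" then show "g \<in> newton G" by (intro newtonI[of "{#g#}"]) (auto simp: exp_le_def)
qed

lemma newton_mono: "G \<subseteq> H \<Longrightarrow> newton G \<subseteq> newton H"
  unfolding newton_def by blast

lemma newton_upward_closed:
  assumes "b \<in> newton G" "b \<preceq> c" shows "c \<in> newton G"
proof -
  obtain M where M: "M \<noteq> {#}" "set_mset M \<subseteq> G" "\<Sum>\<^sub># M \<preceq> size M \<star> b"
    using assms(1) by (rule newtonE)
  moreover have "size M \<star> b \<preceq> size M \<star> c" using assms(2) by (simp add: exp_le_def)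
  ultimately show ?thesis using newtonI exp_le_trans by metis
qed

lemma lookup_sum_repeat_mset:
  "Poly_Mapping.lookup (\<Sum>\<^sub># (repeat_mset n M)) v = n * Poly_Mapping.lookup (\<Sum>\<^sub># M) v"
proof (induction n)
  case (Suc n)
  have "repeat_mset (Suc n) M = M + repeat_mset n M" by (rule multiset_eqI) simp
  then show ?case using Suc by (simp add: lookup_add)
qed simp

lemma set_repeat_mset: "n \<ge> 1 \<Longrightarrow> set_mset (repeat_mset n M) = set_mset M"
  by (auto simp flip: count_greater_zero_iff)

text \<open>A common denominator for the convex combinations that witness the members of \<open>B\<close>.\<close>

lemma newton_common_multiple:
  assumes "set_mset B \<subseteq> newton X"
  obtains N M where "N \<ge> 1" "set_mset M \<subseteq> X" "size M = N * size B" "\<Sum>\<^sub># M \<preceq> N \<star> \<Sum>\<^sub># B"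
  using assms
proof (induction B arbitrary: thesis)
  case empty
  show ?case by (rule empty.prems(1)[of 1 "{#}"]) (auto simp: exp_le_def)
next
  case (add b B)
  have B: "set_mset B \<subseteq> newton X" "b \<in> newton X" using add.prems(2) by simp_all
  obtain N M where M: "N \<ge> 1" "set_mset M \<subseteq> X" "size M = N * size B" "\<Sum>\<^sub># M \<preceq> N \<star> \<Sum>\<^sub># B"
    by (rule add.IH[OF _ B(1)])
  obtain K where K: "K \<noteq> {#}" "set_mset K \<subseteq> X" "\<Sum>\<^sub># K \<preceq> size K \<star> b"
    using B(2) by (rule newtonE)
  let ?L = "repeat_mset (size K) M + repeat_mset N K"
  have s: "size K \<ge> 1" using K(1) by (simp add: Suc_leI nonempty_has_size)
  have "Poly_Mapping.lookup (\<Sum>\<^sub># ?L) v \<le> (N * size K) * Poly_Mapping.lookup (\<Sum>\<^sub># (add_mset b B)) v" for v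
  proof -
    have "Poly_Mapping.lookup (\<Sum>\<^sub># M) v \<le> N * Poly_Mapping.lookup (\<Sum>\<^sub># B) v"
      "Poly_Mapping.lookup (\<Sum>\<^sub># K) v \<le> size K * Poly_Mapping.lookup b v"
      using M(4) K(3) by (simp_all add: exp_le_def)
    from add_mono[OF mult_le_mono2[OF this(1), of "size K"] mult_le_mono2[OF this(2), of N]]
    show ?thesis by (simp add: lookup_add lookup_sum_repeat_mset algebra_simps del: mult_le_cancel1)
  qed
  then have "\<Sum>\<^sub># ?L \<preceq> (N * size K) \<star> \<Sum>\<^sub># (add_mset b B)" unfolding exp_le_def lookup_multiple by blast
  moreover have "set_mset ?L \<subseteq> X" using M K s by (simp add: set_repeat_mset)
  moreover have "size ?L = (N * size K) * size (add_mset b B)"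
    using M(3) by (simp add: algebra_simps)
  moreover have "N * size K \<ge> 1" using M(1) s by simp
  ultimately show ?case by (intro add.prems(1))
qed

lemma newton_idem: "newton (newton X) \<subseteq> newton X"
proof
  fix b assume "b \<in> newton (newton X)"
  then obtain B where B: "B \<noteq> {#}" "set_mset B \<subseteq> newton X" "\<Sum>\<^sub># B \<preceq> size B \<star> b" by (rule newtonE)
  obtain N M where M: "N \<ge> 1" "set_mset M \<subseteq> X" "size M = N * size B" "\<Sum>\<^sub># M \<preceq> N \<star> \<Sum>\<^sub># B"
    using B(2) by (rule newton_common_multiple)
  have "N \<star> \<Sum>\<^sub># B \<preceq> size M \<star> b" using B(3) by (simp add: M(3) exp_le_def mult.assoc)
  then show "b \<in> newton X"
    using M B(1) by (intro newtonI[of M]) (auto intro: exp_le_trans)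
qed

text \<open>If some members of \<open>L\<close> differ from \<open>b\<close>, cancel the copies of \<open>b\<close> on both sides: the average of
the remaining members is still below \<open>b\<close>, so \<open>b\<close> lies in the polyhedron of \<open>Y\<close>.\<close>

lemma eq_vertex_if_average_below:
  assumes b: "b \<notin> newton Y" and L: "set_mset L \<subseteq> insert b Y"
    and le: "\<Sum>\<^sub># L \<preceq> size L \<star> b" and "x \<in># L"
  shows "x = b"
proof -
  define K where "K = filter_mset (\<lambda>x. x \<noteq> b) L"
  have LK: "L = replicate_mset (count L b) b + K"
    unfolding K_def by (metis filter_eq_replicate_mset multiset_partition)
  have "K = {#}"
  proof (rule ccontr)
    assume "K \<noteq> {#}"
    moreover have "set_mset K \<subseteq> Y" using L by (auto simp: K_def)
    moreover have "\<Sum>\<^sub># K \<preceq> size K \<star> b"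
      unfolding exp_le_def
    proof
      fix v
      have "\<Sum>\<^sub># L = count L b \<star> b + \<Sum>\<^sub># K"
        using LK by (metis multiple_def sum_mset.union)
      moreover have "size L = count L b + size K"
        using LK by (metis size_replicate_mset size_union)
      moreover have "Poly_Mapping.lookup (\<Sum>\<^sub># L) v \<le> size L * Poly_Mapping.lookup b v"
        using le by (simp add: exp_le_def)
      ultimately show "Poly_Mapping.lookup (\<Sum>\<^sub># K) v \<le> Poly_Mapping.lookup (size K \<star> b) v"
        by (simp add: add_mult_distrib lookup_add)
    qed
    ultimately show False using b newtonI by blast
  qed
  then show ?thesis using LK \<open>x \<in># L\<close> by (metis add.right_neutral in_replicate_mset)
qed

text \<open>The hypothesis on \<open>b\<close> makes it a vertex of the polyhedron of \<open>insert b Y\<close>, and a vertex is not an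
average of other points. After writing the members of \<open>B\<close> as convex combinations with a common
denominator, \<open>eq_vertex_if_average_below\<close> shows that only \<open>b\<close> occurs in them, so every
member of \<open>B\<close> lies above \<open>b\<close>; as their average lies below \<open>b\<close>, they are all equal to \<open>b\<close>.\<close>

lemma newton_vertex_multiset:
  assumes b: "b \<notin> newton Y"
    and B: "set_mset B \<subseteq> newton (insert b Y)" "\<Sum>\<^sub># B \<preceq> size B \<star> b"
    and c: "c \<in># B"
  shows "c = b"
proof -
  have ge: "b \<preceq> c'" if "c' \<in># B" for c'
  proof -
    obtain B' where B': "B = add_mset c' B'" using \<open>c' \<in># B\<close> by (meson multi_member_split)
    have sub: "set_mset {#c'#} \<subseteq> newton (insert b Y)" "set_mset B' \<subseteq> newton (insert b Y)"
      using B(1) by (simp_all add: B')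
    obtain N M where M: "N \<ge> 1" "set_mset M \<subseteq> insert b Y" "size M = N * size {#c'#}"
      "\<Sum>\<^sub># M \<preceq> N \<star> \<Sum>\<^sub># {#c'#}"
      using sub(1) by (rule newton_common_multiple)
    obtain N' M' where M': "N' \<ge> 1" "set_mset M' \<subseteq> insert b Y" "size M' = N' * size B'"
      "\<Sum>\<^sub># M' \<preceq> N' \<star> \<Sum>\<^sub># B'"
      using sub(2) by (rule newton_common_multiple)
    \<comment> \<open>\<open>L\<close> represents the multiset \<open>B\<close>, scaled by the common denominator \<open>N * N'\<close>\<close>
    define L where "L = repeat_mset N' M + repeat_mset N M'"
    have sizeL: "size L = N * N' * size B"
      unfolding L_def B' by (simp add: M(3) M'(3) algebra_simps)
    have "Poly_Mapping.lookup (\<Sum>\<^sub># L) v \<le> size L * Poly_Mapping.lookup b v" for v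
    proof -
      have "Poly_Mapping.lookup (\<Sum>\<^sub># L) v
          = N' * Poly_Mapping.lookup (\<Sum>\<^sub># M) v + N * Poly_Mapping.lookup (\<Sum>\<^sub># M') v"
        by (simp add: L_def lookup_add lookup_sum_repeat_mset)
      also have "\<dots> \<le> N' * (N * Poly_Mapping.lookup c' v) + N * (N' * Poly_Mapping.lookup (\<Sum>\<^sub># B') v)"
        using M(4) M'(4) by (intro add_mono mult_le_mono2) (simp_all add: exp_le_def)
      also have "\<dots> = (N * N') * Poly_Mapping.lookup (\<Sum>\<^sub># B) v"
        by (simp add: B' lookup_add algebra_simps)
      also have "\<dots> \<le> (N * N') * (size B * Poly_Mapping.lookup b v)"
        using B(2) by (intro mult_le_mono2) (simp add: exp_le_def)
      finally show ?thesis by (simp add: sizeL mult.assoc)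
    qed
    then have "\<Sum>\<^sub># L \<preceq> size L \<star> b" by (simp add: exp_le_def)
    moreover have "set_mset L \<subseteq> insert b Y"
      unfolding L_def using M(1,2) M'(1,2) by (simp add: set_repeat_mset)
    ultimately have "x = b" if "x \<in># L" for x
      using eq_vertex_if_average_below[OF b] that by blast
    moreover have "set_mset M \<subseteq> set_mset L" unfolding L_def using M'(1) by (simp add: set_repeat_mset)
    ultimately have "set_mset M \<subseteq> {b}" by blast
    then have "M = replicate_mset N b" using M(3)
      by (metis set_mset_subset_singletonD size_single mult.right_neutral)
    then have "N \<star> b \<preceq> N \<star> c'" using M(4) by (simp add: multiple_def)
    then show ?thesis using M(1) by (simp add: exp_le_def)
  qed
  have *: "size C \<star> b \<preceq> \<Sum>\<^sub># C" if "\<forall>c\<in>#C. b \<preceq> c" for C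
    using that by (induction C) (auto simp: multiple_Suc exp_le_add_mono)
  obtain B' where B': "B = add_mset c B'" using c by (meson multi_member_split)
  show "c = b"
  proof (rule poly_mapping_eqI)
    fix v
    have "Poly_Mapping.lookup c v + Poly_Mapping.lookup (\<Sum>\<^sub># B') v
        \<le> Poly_Mapping.lookup b v + size B' * Poly_Mapping.lookup b v"
      using B(2) by (simp add: B' exp_le_def lookup_add)
    moreover have "size B' * Poly_Mapping.lookup b v \<le> Poly_Mapping.lookup (\<Sum>\<^sub># B') v"
      using *[of B'] ge by (simp add: B' exp_le_def)
    moreover have "Poly_Mapping.lookup b v \<le> Poly_Mapping.lookup c v"
      using ge[OF c] by (simp add: exp_le_def)
    ultimately show "Poly_Mapping.lookup c v = Poly_Mapping.lookup b v" by linarith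
  qed
qed

section \<open>Integral closures of monomial ideals\<close>

lemma keys_power: "Poly_Mapping.keys (f ^ d) \<subseteq> sums_of d (Poly_Mapping.keys (f :: ('v, 'k::comm_ring_1) mpoly))"
proof (induction d)
  case (Suc d)
  have "f ^ Suc d = f ^ d * f" by (simp add: mult.commute)
  then show ?case
    using Suc keys_mult[of "f ^ d" f] unfolding sums_of_Suc by (simp del: power_Suc) blast
qed simp

lemma lookup_power_vertex:
  fixes f :: "('v, 'k::comm_ring_1) mpoly"
  assumes "\<And>B c. set_mset B \<subseteq> Poly_Mapping.keys f \<Longrightarrow> \<Sum>\<^sub># B = size B \<star> b \<Longrightarrow>
    c \<in># B \<Longrightarrow> c = b"
  shows "Poly_Mapping.lookup (f ^ d) (d \<star> b) = Poly_Mapping.lookup f b ^ d"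
proof (induction d)
  case (Suc d)
  have "Poly_Mapping.lookup (f * f ^ d) (b + d \<star> b) =
    Poly_Mapping.lookup f b * Poly_Mapping.lookup (f ^ d) (d \<star> b)"
  proof (rule lookup_mult_unique)
    fix s t assume st: "s \<in> Poly_Mapping.keys f" "t \<in> Poly_Mapping.keys (f ^ d)"
      "s + t = b + d \<star> b"
    obtain L where L: "t = \<Sum>\<^sub># L" "set_mset L \<subseteq> Poly_Mapping.keys f" "size L = d"
      using st(2) keys_power[of f d] by (auto simp: sums_of_def)
    have "s = b" by (rule assms[of "add_mset s L"]) (use st L in \<open>auto simp: multiple_Suc\<close>)
    then show "s = b \<and> t = d \<star> b" using st(3) by simp
  qed
  then show ?case using Suc by (simp add: multiple_Suc)
qed simp

text \<open>Choose a smallest set \<open>W\<close> of exponents of \<open>f\<close> that together with \<open>G\<close> spans a polyhedron containing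
all exponents of \<open>f\<close>. Any \<open>b\<close> in \<open>W\<close> is a vertex of this polyhedron, so the term of \<open>f\<^sup>d\<close>
with exponent \<open>d b\<close> does not cancel within \<open>f\<^sup>d\<close>. It does not occur in \<open>a\<^sub>i f\<^bsup>d-i\<^esup>\<close> either:
there, \<open>d b\<close> would lie above a sum of \<open>i\<close> elements of \<open>G\<close> and \<open>d - i\<close> exponents of \<open>f\<close>, and
by \<open>newton_vertex_multiset\<close> all of them would equal \<open>b\<close>, although \<open>b\<close> is not in \<open>G\<close>. This contradicts the
equation of integral dependence, so \<open>W\<close> is empty.\<close>

lemma keys_subset_newton_if_integral:
  fixes f :: "('v, 'k::idom) mpoly"
  assumes "d \<ge> 1" and a: "\<And>i. i \<in> {1..d} \<Longrightarrow> a i \<in> monomial_ideal V (sums_of i G)"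
    and eq: "f ^ d + (\<Sum>i\<in>{1..d}. a i * f ^ (d - i)) = 0"
  shows "Poly_Mapping.keys f \<subseteq> newton G"
proof -
  let ?F = "Poly_Mapping.keys f"
  let ?S = "{W. W \<subseteq> ?F \<and> ?F \<subseteq> newton (W \<union> G)}"
  have "?F \<in> ?S" using subset_newton by blast
  moreover have "finite ?S" by (rule finite_subset[of _ "Pow ?F"]) auto
  ultimately obtain W where "is_arg_min card (\<lambda>W. W \<in> ?S) W"
    using ex_is_arg_min_if_finite[of ?S card] by auto
  then have W: "W \<in> ?S" and min: "\<And>W'. W' \<in> ?S \<Longrightarrow> card W \<le> card W'"
    by (auto simp: is_arg_min_linorder)
  have "W = {}"
  proof (rule ccontr)
    assume "W \<noteq> {}"
    then obtain b where b: "b \<in> W" by blast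
    let ?Y = "W - {b} \<union> G"
    have bF: "b \<in> ?F" using W b by blast
    have finW: "finite W" using W finite_subset[of W ?F] by simp
    have bY: "b \<notin> newton ?Y"
    proof
      assume "b \<in> newton ?Y"
      then have "W \<union> G \<subseteq> newton ?Y" using subset_newton[of ?Y] by blast
      then have "?F \<subseteq> newton ?Y" using W newton_mono newton_idem by blast
      then have "card W \<le> card (W - {b})" using W by (intro min) auto
      then show False using b finW by (meson card_Diff1_less leD)
    qed
    have sub: "?F \<union> G \<subseteq> newton (insert b ?Y)"
    proof -
      have "insert b ?Y = W \<union> G" using b by blast
      then show ?thesis using W subset_newton[of "W \<union> G"] by auto
    qed
    have ext: "c = b" if "set_mset B \<subseteq> ?F \<union> G" "\<Sum>\<^sub># B \<preceq> size B \<star> b" "c \<in># B" for B c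
      by (rule newton_vertex_multiset[OF bY _ _ that(3)])
         (use that(1,2) sub in \<open>auto simp: \<close>)
    let ?t = "d \<star> b"
    have "Poly_Mapping.lookup (f ^ d) ?t = Poly_Mapping.lookup f b ^ d"
      by (rule lookup_power_vertex, rule ext) auto
    then have "Poly_Mapping.lookup (f ^ d) ?t \<noteq> 0" using bF by (simp add: in_keys_iff)
    moreover have "Poly_Mapping.lookup (a i * f ^ (d - i)) ?t = 0" if i: "i \<in> {1..d}" for i
    proof (rule ccontr)
      assume "Poly_Mapping.lookup (a i * f ^ (d - i)) ?t \<noteq> 0"
      then have "?t \<in> Poly_Mapping.keys (a i * f ^ (d - i))" by (simp add: in_keys_iff)
      then obtain s u where su: "?t = s + u" "s \<in> Poly_Mapping.keys (a i)" "u \<in> Poly_Mapping.keys (f ^ (d - i))"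
        using keys_mult by blast
      obtain e where "e \<in> sums_of i G" and e: "e \<preceq> s"
        using a[OF i] su(2) unfolding monomial_ideal_def by blast
      then obtain K where K: "e = \<Sum>\<^sub># K" "set_mset K \<subseteq> G" "size K = i" by (auto simp: sums_of_def)
      obtain L where L: "u = \<Sum>\<^sub># L" "set_mset L \<subseteq> ?F" "size L = d - i"
        using su(3) keys_power[of f "d - i"] by (auto simp: sums_of_def)
      have "K \<noteq> {#}" using K(3) i by auto
      then obtain g where g: "g \<in># K" by blast
      have "g = b"
      proof (rule ext[of "K + L"])
        have "\<Sum>\<^sub># (K + L) \<preceq> ?t" using su(1) e K(1) L(1) by (simp add: exp_le_add_mono)
        then show "\<Sum>\<^sub># (K + L) \<preceq> size (K + L) \<star> b" using K(3) L(3) i by simp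
      qed (use K L g in auto)
      then show False using g K(2) subset_newton[of ?Y] bY by blast
    qed
    ultimately have "Poly_Mapping.lookup (f ^ d + (\<Sum>i\<in>{1..d}. a i * f ^ (d - i))) ?t \<noteq> 0"
      by (simp add: lookup_add lookup_sum)
    then show False using eq by simp
  qed
  then show ?thesis using W by simp
qed

text \<open>For \<open>J i\<close> the \<open>i\<close>-th power of an ideal, these are the polynomials that are homogeneous of degree \<open>d\<close> when
elements of \<open>J i\<close> get degree \<open>i\<close> and the indeterminate gets degree \<open>1\<close>. A monic polynomial of
degree \<open>d\<close> in this set is an equation of integral dependence.\<close>

definition weighted_coeffs :: "(nat \<Rightarrow> 'a::comm_ring_1 set) \<Rightarrow> nat \<Rightarrow> 'a poly \<Rightarrow> bool"
  where "weighted_coeffs J d p \<longleftrightarrow> (\<forall>j. coeff p j = 0 \<or> j \<le> d \<and> coeff p j \<in> J (d - j))"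

text \<open>Each entry of \<open>X - A\<close> is homogeneous of degree \<open>1\<close>, and each term of the determinant is a product of
\<open>n\<close> entries.\<close>

lemma weighted_coeffs_char_poly:
  fixes A :: "'a::comm_ring_1 mat"
  assumes A: "A \<in> carrier_mat n n" "\<And>i j. i < n \<Longrightarrow> j < n \<Longrightarrow> A $$ (i, j) \<in> J 1"
    and J: "1 \<in> J 0" "\<And>i. 0 \<in> J i" "\<And>i x. x \<in> J i \<Longrightarrow> - x \<in> J i"
      "\<And>i x y. x \<in> J i \<Longrightarrow> y \<in> J i \<Longrightarrow> x + y \<in> J i"
      "\<And>i j x y. x \<in> J i \<Longrightarrow> y \<in> J j \<Longrightarrow> x * y \<in> J (i + j)"
  shows "weighted_coeffs J n (char_poly A)"
proof -
  have add: "weighted_coeffs J d (p + q)" if "weighted_coeffs J d p" "weighted_coeffs J d q" for d p q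
    unfolding weighted_coeffs_def
  proof
    fix j
    show "coeff (p + q) j = 0 \<or> j \<le> d \<and> coeff (p + q) j \<in> J (d - j)"
      using that J(4) unfolding weighted_coeffs_def coeff_add by (metis add.left_neutral add.right_neutral)
  qed
  have Jsum: "sum h I \<in> J i" if "\<And>x. x \<in> I \<Longrightarrow> h x \<in> J i" for h :: "nat \<Rightarrow> 'a" and I i
    using that J(2,4) by (induction I rule: infinite_finite_induct) auto
  have mult: "weighted_coeffs J (d + e) (p * q)" if p: "weighted_coeffs J d p" and q: "weighted_coeffs J e q" for d e p q
    unfolding weighted_coeffs_def
  proof
    fix j
    have trm: "coeff p i * coeff q (j - i) = 0 \<or> j \<le> d + e \<and> coeff p i * coeff q (j - i) \<in> J (d + e - j)" if "i \<le> j" for i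
    proof (cases "coeff p i = 0 \<or> coeff q (j - i) = 0")
      case False
      then have *: "i \<le> d" "coeff p i \<in> J (d - i)" "j - i \<le> e" "coeff q (j - i) \<in> J (e - (j - i))"
        using p q unfolding weighted_coeffs_def by blast+
      have "d - i + (e - (j - i)) = d + e - j" using * that by linarith
      then show ?thesis using J(5)[OF *(2,4)] * that by auto
    qed auto
    show "coeff (p * q) j = 0 \<or> j \<le> d + e \<and> coeff (p * q) j \<in> J (d + e - j)"
    proof (cases "j \<le> d + e")
      case True
      then have "coeff (p * q) j \<in> J (d + e - j)"
        unfolding coeff_mult by (intro Jsum) (use trm J(2) in force)
      then show ?thesis using True by blast
    next
      case False
      then have "coeff (p * q) j = 0"
        unfolding coeff_mult by (intro sum.neutral) (use trm in auto)
      then show ?thesis by blast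
    qed
  qed
  have one: "weighted_coeffs J 0 1"
    using J(1) by (auto simp: weighted_coeffs_def coeff_1)
  have prod: "weighted_coeffs J (card I) (prod h I)" if "finite I" "\<And>i. i \<in> I \<Longrightarrow> weighted_coeffs J 1 (h i)"
    for h :: "nat \<Rightarrow> 'a poly" and I
    using that
  proof (induction I rule: finite_induct)
    case (insert x I)
    then show ?case using mult[of 1 "h x" "card I" "prod h I"] by simp
  qed (simp add: one)
  have neg: "weighted_coeffs J d (- p)" if "weighted_coeffs J d p" for d p
    using that J(3) by (auto simp: weighted_coeffs_def)
  have entry: "weighted_coeffs J 1 (char_poly_matrix A $$ (i, j))" if "i < n" "j < n" for i j
  proof -
    have "char_poly_matrix A $$ (i, j) = (if i = j then [:- A $$ (i, j), 1:] else [:- A $$ (i, j):])"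
      using that A(1) by (simp add: char_poly_matrix_def)
    then show ?thesis
      using J(1) J(3)[OF A(2)[OF that]] by (auto simp: weighted_coeffs_def coeff_pCons split: nat.splits)
  qed
  have "weighted_coeffs J n (\<Sum>p\<in>{p. p permutes {0..<n}}. signof p * (\<Prod>i = 0..<n. char_poly_matrix A $$ (i, p i)))"
    (is "weighted_coeffs J n (sum ?h ?P)")
  proof -
    have "weighted_coeffs J n (?h p)" if "p permutes {0..<n}" for p
    proof -
      have "weighted_coeffs J (card {0..<n}) (\<Prod>i = 0..<n. char_poly_matrix A $$ (i, p i))"
        using permutes_in_image[OF that] by (intro prod entry) auto
      then show ?thesis using neg by (cases "sign p = 1") (auto simp: sign_def)
    qed
    moreover have sums: "weighted_coeffs J n (sum h S)" if "\<And>x. x \<in> S \<Longrightarrow> weighted_coeffs J n (h x)"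
      for h :: "(nat \<Rightarrow> nat) \<Rightarrow> 'a poly" and S
      using that
      by (induction S rule: infinite_finite_induct) (simp_all add: add, simp_all add: weighted_coeffs_def)
    ultimately show ?thesis by (intro sums) simp
  qed
  then show ?thesis
    using det_def'[OF char_poly_matrix_closed[OF A(1)]] by (simp add: char_poly_def)
qed

lemma weighted_equation:
  fixes A :: "'a::comm_ring_1 mat"
  assumes A: "A \<in> carrier_mat n n" and n: "n \<ge> 1"
    and w: "weighted_coeffs J n (char_poly A)" and J0: "\<And>i. 0 \<in> J i"
    and root: "poly (char_poly A) x = 0"
  shows "\<exists>a. (\<forall>i\<in>{1..n}. a i \<in> J i) \<and> x ^ n + (\<Sum>i\<in>{1..n}. a i * x ^ (n - i)) = 0"
proof (intro exI conjI ballI)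
  let ?a = "\<lambda>i. coeff (char_poly A) (n - i)"
  fix i assume "i \<in> {1..n}"
  then show "?a i \<in> J i"
    using w J0 unfolding weighted_coeffs_def by (metis atLeastAtMost_iff diff_diff_cancel)
next
  let ?a = "\<lambda>i. coeff (char_poly A) (n - i)"
  have deg: "degree (char_poly A) = n" "coeff (char_poly A) n = 1"
    using degree_monic_char_poly[OF A] by auto
  have "poly (char_poly A) x = (\<Sum>j\<le>n. coeff (char_poly A) j * x ^ j)"
    by (simp add: poly_altdef deg)
  also have "\<dots> = x ^ n + (\<Sum>j<n. coeff (char_poly A) j * x ^ j)"
    by (simp add: lessThan_Suc_atMost[symmetric] deg)
  also have "(\<Sum>j<n. coeff (char_poly A) j * x ^ j) = (\<Sum>i\<in>{1..n}. ?a i * x ^ (n - i))"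
    by (rule sum.reindex_bij_witness[of _ "\<lambda>i. n - i" "\<lambda>j. n - j"]) auto
  finally show "x ^ n + (\<Sum>i\<in>{1..n}. ?a i * x ^ (n - i)) = 0" using root by simp
qed

text \<open>The determinant trick: \<open>x - A\<close> annihilates the vector \<open>v\<close>, hence so does its determinant, by
multiplication with the adjugate matrix.\<close>

lemma poly_char_poly_eq_0:
  fixes A :: "'a::comm_ring_1 mat"
  assumes A: "A \<in> carrier_mat n n" and v: "\<And>i. i < n \<Longrightarrow> x * v i = (\<Sum>j<n. A $$ (i, j) * v j)"
    and k: "k < n" "\<And>y. y * v k = 0 \<Longrightarrow> y = 0"
  shows "poly (char_poly A) x = 0"
proof -
  define B where "B = map_mat (\<lambda>p. poly p x) (char_poly_matrix A)"
  have B: "B \<in> carrier_mat n n" using A by (simp add: B_def)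
  have entry: "B $$ (i, j) = (if i = j then x else 0) - A $$ (i, j)" if "i < n" "j < n" for i j
    using that A by (simp add: B_def char_poly_matrix_def)
  have det: "det B = poly (char_poly A) x"
    unfolding B_def char_poly_def by (rule comm_ring_hom.hom_det) (unfold_locales, auto)
  define u where "u = vec n v"
  have u: "u \<in> carrier_vec n" by (simp add: u_def)
  have Bu: "B *\<^sub>v u = 0\<^sub>v n"
  proof (rule eq_vecI)
    fix i assume "i < dim_vec (0\<^sub>v n :: 'a vec)"
    then have i: "i < n" by simp
    have "(B *\<^sub>v u) $ i = (\<Sum>j<n. B $$ (i, j) * v j)"
      using B i by (simp add: u_def scalar_prod_def atLeast0LessThan)
    also have "\<dots> = (\<Sum>j<n. (if i = j then x * v j else 0) - A $$ (i, j) * v j)"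
      by (rule sum.cong) (use i in \<open>auto simp: entry left_diff_distrib\<close>)
    also have "\<dots> = x * v i - (\<Sum>j<n. A $$ (i, j) * v j)"
      using i by (simp add: sum_subtractf)
    finally show "(B *\<^sub>v u) $ i = 0\<^sub>v n $ i" using v[OF i] i by simp
  qed (use B in auto)
  have "(adj_mat B * B) *\<^sub>v u = adj_mat B *\<^sub>v (B *\<^sub>v u)"
    by (rule assoc_mult_mat_vec[OF adj_mat(1)[OF B] B u])
  moreover have "adj_mat B *\<^sub>v 0\<^sub>v n = 0\<^sub>v n"
    using adj_mat(1)[OF B] by (intro eq_vecI) auto
  ultimately have "(det B \<cdot>\<^sub>m 1\<^sub>m n) *\<^sub>v u = 0\<^sub>v n"
    by (simp only: Bu adj_mat(3)[OF B])
  moreover have "((det B \<cdot>\<^sub>m 1\<^sub>m n) *\<^sub>v u) $ k = det B * v k"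
  proof -
    have "((det B \<cdot>\<^sub>m 1\<^sub>m n) *\<^sub>v u) $ k = (\<Sum>j<n. (if k = j then det B * v j else 0))"
      using k(1) unfolding u_def by (simp add: scalar_prod_def atLeast0LessThan if_distrib if_distribR cong: if_cong)
    then show ?thesis using k(1) by simp
  qed
  ultimately have "det B * v k = 0" using k(1) by simp
  then show ?thesis using k(2) det by simp
qed

text \<open>Among more than \<open>\<Sum>b\<in>F. size (K b)\<close> summands, either one belongs to \<open>G\<close>, or some \<open>b\<close> occurs at
least \<open>size (K b)\<close> times and that many copies of \<open>b\<close> can be replaced by the members of \<open>K b\<close>, all
of which belong to \<open>G\<close>. For the ideals \<open>J\<close> and \<open>L\<close> with exponents \<open>G\<close> and \<open>F \<union> G\<close>, this is the
inclusion of \<open>L\<^bsup>D+1\<^esup>\<close> in \<open>J L\<^sup>D\<close>.\<close>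

lemma newton_absorption:
  fixes F G :: "('v \<Rightarrow>\<^sub>0 nat) set"
  assumes F: "finite F" and K: "\<And>b. b \<in> F \<Longrightarrow> K b \<noteq> {#}" "\<And>b. b \<in> F \<Longrightarrow> set_mset (K b) \<subseteq> G"
      "\<And>b. b \<in> F \<Longrightarrow> \<Sum>\<^sub># (K b) \<preceq> size (K b) \<star> b"
    and t: "t \<in> sums_of (Suc (\<Sum>b\<in>F. size (K b))) (F \<union> G)"
  shows "\<exists>g\<in>G. \<exists>w\<in>sums_of (\<Sum>b\<in>F. size (K b)) (F \<union> G). g + w \<preceq> t"
proof -
  let ?D = "\<Sum>b\<in>F. size (K b)"
  obtain M where M: "t = \<Sum>\<^sub># M" "set_mset M \<subseteq> F \<union> G" "size M = Suc ?D"
    using t by (auto simp: sums_of_def)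
  show ?thesis
  proof (cases "\<exists>g\<in>#M. g \<in> G")
    case True
    then obtain g M' where g: "g \<in> G" "M = add_mset g M'" by (meson multi_member_split)
    then have "\<Sum>\<^sub># M' \<in> sums_of ?D (F \<union> G)" using M unfolding sums_of_def by auto
    moreover have "g + \<Sum>\<^sub># M' \<preceq> t" using g M by simp
    ultimately show ?thesis using g(1) by blast
  next
    case False
    then have MF: "set_mset M \<subseteq> F" using M(2) by blast
    have "\<exists>b\<in>F. size (K b) \<le> count M b"
    proof (rule ccontr)
      assume "\<not> ?thesis"
      then have "(\<Sum>b\<in>F. count M b) \<le> ?D" by (intro sum_mono) auto
      moreover have "size M = (\<Sum>b\<in>F. count M b)"
        unfolding size_multiset_overloaded_eq using MF F
        by (intro sum.mono_neutral_left) (auto simp: not_in_iff)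
      ultimately show False using M(3) by simp
    qed
    then obtain b where b: "b \<in> F" "size (K b) \<le> count M b" by blast
    define M' where "M' = M - replicate_mset (size (K b)) b"
    have MM': "M = replicate_mset (size (K b)) b + M'"
      unfolding M'_def using b(2) by (simp add: count_le_replicate_mset_subset_eq)
    obtain g K' where g: "K b = add_mset g K'" using K(1)[OF b(1)] by (meson multiset_cases)
    have "\<Sum>\<^sub># (K' + M') \<in> sums_of ?D (F \<union> G)"
    proof -
      have "set_mset (K' + M') \<subseteq> F \<union> G"
        using K(2)[OF b(1)] MF g MM' by auto
      moreover have "size M = size (K b) + size M'" using MM' by (metis size_replicate_mset size_union)
      then have "size (K' + M') = ?D" using M(3) g by simp
      ultimately show ?thesis unfolding sums_of_def by blast
    qed
    moreover have "g + \<Sum>\<^sub># (K' + M') \<preceq> t"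
    proof -
      have "t = size (K b) \<star> b + \<Sum>\<^sub># M'" using M(1) MM' by (metis multiple_def sum_mset.union)
      moreover have "g + \<Sum>\<^sub># (K' + M') = \<Sum>\<^sub># (K b) + \<Sum>\<^sub># M'" using g by (simp add: add.assoc)
      ultimately show ?thesis using K(3)[OF b(1)] by (simp add: exp_le_add_mono)
    qed
    moreover have "g \<in> G" using K(2)[OF b(1)] g by simp
    ultimately show ?thesis by blast
  qed
qed

text \<open>By \<open>newton_absorption\<close>, multiplication by \<open>f\<close> maps the generators of \<open>L\<^sup>D\<close>, the monomials with
exponents in \<open>W\<close>, to combinations of these generators with coefficients in the ideal of \<open>G\<close>. The
characteristic polynomial of the matrix of coefficients is the desired equation.\<close>

lemma integral_if_keys_subset_newton:
  fixes f :: "('v, 'k::idom) mpoly"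
  assumes G: "finite G" "\<And>g. g \<in> G \<Longrightarrow> Poly_Mapping.keys g \<subseteq> V"
    and f: "vars f \<subseteq> V" "Poly_Mapping.keys f \<subseteq> newton G"
  shows "\<exists>d a. d \<ge> 1 \<and> (\<forall>i\<in>{1..d}. a i \<in> monomial_ideal V (sums_of i G)) \<and>
    f ^ d + (\<Sum>i\<in>{1..d}. a i * f ^ (d - i)) = 0"
proof (cases "f = 0")
  case True
  then show ?thesis by (intro exI[of _ 1] exI[of _ "\<lambda>_. 0"]) simp
next
  case False
  let ?F = "Poly_Mapping.keys f"
  have "\<forall>b\<in>?F. \<exists>K. K \<noteq> {#} \<and> set_mset K \<subseteq> G \<and> \<Sum>\<^sub># K \<preceq> size K \<star> b"
    using f(2) unfolding newton_def by blast
  then obtain K where K: "\<And>b. b \<in> ?F \<Longrightarrow> K b \<noteq> {#}" "\<And>b. b \<in> ?F \<Longrightarrow> set_mset (K b) \<subseteq> G"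
      "\<And>b. b \<in> ?F \<Longrightarrow> \<Sum>\<^sub># (K b) \<preceq> size (K b) \<star> b"
    by metis
  define D where "D = (\<Sum>b\<in>?F. size (K b))"
  \<comment> \<open>exponents of the generators of the \<open>D\<close>-th power of the ideal generated by \<open>G\<close> and the terms of \<open>f\<close>\<close>
  define W where "W = sums_of D (?F \<union> G)"
  have keysF: "Poly_Mapping.keys b \<subseteq> V" if "b \<in> ?F" for b
    using f(1) that by (auto simp: vars_subset_iff)
  have keysW: "Poly_Mapping.keys w \<subseteq> V" if "w \<in> W" for w
    by (rule keys_sums_of[OF that[unfolded W_def]]) (use keysF G(2) in blast)
  have "\<forall>b\<in>?F. \<forall>w\<in>W. \<exists>g\<in>G. \<exists>w'\<in>W. g + w' \<preceq> b + w"
  proof (intro ballI)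
    fix b w assume "b \<in> ?F" "w \<in> W"
    then have "b + w \<in> sums_of (1 + D) (?F \<union> G)" unfolding W_def by (intro sums_of_add sums_of_1) auto
    then show "\<exists>g\<in>G. \<exists>w'\<in>W. g + w' \<preceq> b + w"
      using newton_absorption[OF finite_keys K] unfolding W_def D_def by simp
  qed
  then obtain g s where gs: "\<And>b w. b \<in> ?F \<Longrightarrow> w \<in> W \<Longrightarrow> g b w \<in> G \<and> s b w \<in> W \<and> g b w + s b w \<preceq> b + w"
    by metis
  define u where "u b w = (b + w) - s b w" for b w
  have u: "u b w + s b w = b + w" "g b w \<preceq> u b w" "Poly_Mapping.keys (u b w) \<subseteq> V"
    if "b \<in> ?F" "w \<in> W" for b w
  proof -
    have gs': "g b w + s b w \<preceq> b + w" using gs that by blast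
    then have "s b w \<preceq> b + w" using exp_le_trans exp_le_add(2) by blast
    then show *: "u b w + s b w = b + w" unfolding u_def by (rule exp_le_diff_add)
    show "g b w \<preceq> u b w" using gs' unfolding *[symmetric] by (simp add: exp_le_def lookup_add)
    have "u b w \<preceq> b + w" unfolding *[symmetric] by simp
    then have "Poly_Mapping.keys (u b w) \<subseteq> Poly_Mapping.keys (b + w)" by (rule keys_mono)
    then show "Poly_Mapping.keys (u b w) \<subseteq> V"
      using keysF keysW that by (fastforce simp: keys_add_nat)
  qed
  have finW: "finite W" unfolding W_def using G(1) by (simp add: finite_sums_of)
  obtain h where h: "bij_betw h {0..<card W} W" using ex_bij_betw_nat_finite[OF finW] by blast
  define n where "n = card W"
  have hW: "h i \<in> W" if "i < n" for i using h that by (auto simp: bij_betw_def n_def)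
  have "?F \<noteq> {}" using False by (metis keys_eq_empty)
  then obtain b0 where "b0 \<in> ?F" by blast
  then have "set_mset (replicate_mset D b0) \<subseteq> ?F \<union> G" by auto
  then have "\<Sum>\<^sub># (replicate_mset D b0) \<in> W"
    unfolding W_def sums_of_def
    by (intro CollectI exI[of _ "replicate_mset D b0"] conjI) simp_all
  then have n: "n \<ge> 1" unfolding n_def using finW by (metis One_nat_def Suc_leI card_gt_0_iff empty_iff)
  \<comment> \<open>row \<open>i\<close> expands \<open>f * monomial (h i)\<close> in the monomials with exponents in \<open>W\<close>\<close>
  define A where "A = mat n n (\<lambda>(i, j). \<Sum>b\<in>?F. if s b (h i) = h j
    then Poly_Mapping.single (u b (h i)) (Poly_Mapping.lookup f b) else 0)"
  have A: "A \<in> carrier_mat n n" by (simp add: A_def)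
  define J where "J i = (monomial_ideal V (sums_of i G) :: ('v, 'k) mpoly set)" for i
  have entries: "A $$ (i, j) \<in> J 1" if "i < n" "j < n" for i j
  proof -
    have "Poly_Mapping.single (u b (h i)) (Poly_Mapping.lookup f b) \<in> J 1" if "b \<in> ?F" for b
    proof -
      have "g b (h i) \<in> sums_of 1 G" using gs[OF that hW[OF \<open>i < n\<close>]] by (intro sums_of_1) blast
      then show ?thesis
        using u(2,3)[OF that hW[OF \<open>i < n\<close>]]
        unfolding J_def by (intro monomial_idealI) (auto split: if_splits)
    qed
    then show ?thesis
      using that unfolding A_def J_def by (auto intro!: monomial_ideal_sum)
  qed
  have wc: "weighted_coeffs J n (char_poly A)"
  proof (rule weighted_coeffs_char_poly[OF A])
    show "A $$ (i, j) \<in> J 1" if "i < n" "j < n" for i j by (rule entries[OF that])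
    show "1 \<in> J 0" unfolding J_def by (auto intro!: monomial_idealI simp: exp_le_def)
    show "x * y \<in> J (i + j)" if "x \<in> J i" "y \<in> J j" for i j x y
      using that unfolding J_def
      by (rule monomial_ideal_mult) (use sums_of_add exp_le_refl in blast)
  qed (simp_all add: J_def monomial_ideal_add monomial_ideal_uminus)
  have root: "poly (char_poly A) f = 0"
  proof (rule poly_char_poly_eq_0[OF A, where v = "\<lambda>i. monomial (h i)" and k = 0])
    fix i assume i: "i < n"
    have "(\<Sum>j<n. A $$ (i, j) * monomial (h j)) =
      (\<Sum>j<n. \<Sum>b\<in>?F. if s b (h i) = h j
        then Poly_Mapping.single (u b (h i) + h j) (Poly_Mapping.lookup f b) else 0)"
      using i by (intro sum.cong refl) (auto simp: A_def sum_distrib_right mult_single intro!: sum.cong)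
    also have "\<dots> = (\<Sum>b\<in>?F. \<Sum>j<n. if s b (h i) = h j
        then Poly_Mapping.single (b + h i) (Poly_Mapping.lookup f b) else 0)"
      by (subst sum.swap) (intro sum.cong refl if_cong, use u(1) hW[OF i] in metis)
    also have "\<dots> = (\<Sum>b\<in>?F. Poly_Mapping.single (b + h i) (Poly_Mapping.lookup f b))"
    proof (rule sum.cong[OF refl])
      fix b assume "b \<in> ?F"
      then have "s b (h i) \<in> W" using gs hW[OF i] by blast
      then obtain j where j: "j < n" "h j = s b (h i)"
        using h unfolding bij_betw_def n_def by (metis atLeastLessThan_iff imageE)
      have "s b (h i) = h j' \<longleftrightarrow> j' = j" if "j' < n" for j'
        using h j that unfolding bij_betw_def n_def inj_on_def by auto
      then have "(\<Sum>j<n. if s b (h i) = h j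
        then Poly_Mapping.single (b + h i) (Poly_Mapping.lookup f b) else 0) =
        (\<Sum>j'<n. if j' = j then Poly_Mapping.single (b + h i) (Poly_Mapping.lookup f b) else 0)"
        by (intro sum.cong) auto
      then show "(\<Sum>j<n. if s b (h i) = h j
        then Poly_Mapping.single (b + h i) (Poly_Mapping.lookup f b) else 0) =
        Poly_Mapping.single (b + h i) (Poly_Mapping.lookup f b)" using j(1) by simp
    qed
    also have "\<dots> = (\<Sum>b\<in>?F. Poly_Mapping.single b (Poly_Mapping.lookup f b)) * monomial (h i)"
      by (simp add: sum_distrib_right mult_single)
    also have "\<dots> = f * monomial (h i)" using mpoly_as_sum[of f] by simp
    finally show "f * monomial (h i) = (\<Sum>j<n. A $$ (i, j) * monomial (h j))" by simp
  next
    fix y :: "('v, 'k) mpoly" assume "y * monomial (h 0) = 0"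
    moreover have "monomial (h 0) \<noteq> (0 :: ('v, 'k) mpoly)" by (metis lookup_single_eq lookup_zero zero_neq_one)
    ultimately show "y = 0" using mpoly_no_zero_divisors by blast
  qed (use n in auto)
  have "\<exists>a. (\<forall>i\<in>{1..n}. a i \<in> J i) \<and> f ^ n + (\<Sum>i\<in>{1..n}. a i * f ^ (n - i)) = 0"
    by (rule weighted_equation[OF A n wc _ root]) (simp add: J_def)
  then show ?thesis using n unfolding J_def by blast
qed

theorem integral_closure_monomial_ideal:
  assumes "finite G" "\<And>g. g \<in> G \<Longrightarrow> Poly_Mapping.keys g \<subseteq> V"
  shows "integral_closure (poly_ring V) (monomial_ideal V G) =
    (monomial_ideal V (newton G) :: ('v, 'k::idom) mpoly set)"
proof -
  have pow: "ideal_pow (poly_ring V) (monomial_ideal V G) i =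
      (monomial_ideal V (sums_of i G) :: ('v, 'k) mpoly set)" for i
    by (rule ideal_pow_monomial_ideal) (rule assms)
  have fs: "finsum (poly_ring V) (\<lambda>i. a i * x ^ (d - i)) {1..d} = (\<Sum>i\<in>{1..d}. a i * x ^ (d - i))"
    if "vars x \<subseteq> V" "\<forall>i\<in>{1..d}. a i \<in> monomial_ideal V (sums_of i G)" for d a and x :: "('v, 'k) mpoly"
  proof (rule finsum_poly_ring)
    fix i assume "i \<in> {1..d}"
    then have "vars (a i) \<subseteq> V" using that(2) monomial_ideal_vars by blast
    then show "vars (a i * x ^ (d - i)) \<subseteq> V"
      using vars_mult[of "a i" "x ^ (d - i)"] vars_power[OF that(1), of "d - i"] by blast
  qed
  have mem: "x \<in> monomial_ideal V (newton G) \<longleftrightarrow> vars x \<subseteq> V \<and> Poly_Mapping.keys x \<subseteq> newton G" for x :: "('v, 'k) mpoly"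
    by (rule mem_monomial_ideal_upward_closed) (rule newton_upward_closed)
  show ?thesis
  proof (intro equalityI subsetI)
    fix x :: "('v, 'k) mpoly" assume "x \<in> integral_closure (poly_ring V) (monomial_ideal V G)"
    then obtain d a where *: "vars x \<subseteq> V" "d \<ge> 1" "\<forall>i\<in>{1..d}. a i \<in> monomial_ideal V (sums_of i G)"
      "x ^ d + finsum (poly_ring V) (\<lambda>i. a i * x ^ (d - i)) {1..d} = 0"
      unfolding integral_closure_def pow by auto
    moreover from this have "x ^ d + (\<Sum>i\<in>{1..d}. a i * x ^ (d - i)) = 0"
      using fs[OF *(1,3)] by simp
    ultimately have "Poly_Mapping.keys x \<subseteq> newton G"
      using keys_subset_newton_if_integral[of d a V G x] by blast
    then show "x \<in> monomial_ideal V (newton G)" using mem *(1) by blast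
  next
    fix x :: "('v, 'k) mpoly" assume "x \<in> monomial_ideal V (newton G)"
    then have x: "vars x \<subseteq> V" "Poly_Mapping.keys x \<subseteq> newton G" using mem by blast+
    then obtain d a where *: "d \<ge> 1" "\<forall>i\<in>{1..d}. a i \<in> monomial_ideal V (sums_of i G)"
      "x ^ d + (\<Sum>i\<in>{1..d}. a i * x ^ (d - i)) = 0"
      using integral_if_keys_subset_newton[OF assms] by blast
    then have "x ^ d + finsum (poly_ring V) (\<lambda>i. a i * x ^ (d - i)) {1..d} = 0"
      using fs[OF x(1) *(2)] by simp
    then show "x \<in> integral_closure (poly_ring V) (monomial_ideal V G)"
      unfolding integral_closure_def pow using x(1) *(1,2) by auto
  qed
qed

section \<open>Symbolic powers of square-free monomial ideals\<close>

text \<open>Localization enters only through this criterion; an element \<open>u * f\<close> of \<open>K\<close> gives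
the fraction \<open>(u * f) / u\<close>, which represents \<open>f / 1\<close>.\<close>

lemma loc_contraction_extension_iff:
  fixes K P :: "('v, 'k::comm_ring_1) mpoly set"
  assumes K: "ideal K (poly_ring V)" and P: "primeideal P (poly_ring V)"
  shows "f \<in> loc_contraction (poly_ring V) P (loc_extension (poly_ring V) P K) \<longleftrightarrow>
    vars f \<subseteq> V \<and> (\<exists>u. vars u \<subseteq> V \<and> u \<notin> P \<and> u * f \<in> K)"
proof -
  interpret K: ideal K "poly_ring V" by fact
  interpret P: primeideal P "poly_ring V" by fact
  have rel: "((a, s), (b, t)) \<in> loc_rel (poly_ring V) P \<longleftrightarrow>
      vars a \<subseteq> V \<and> vars s \<subseteq> V \<and> s \<notin> P \<and> vars b \<subseteq> V \<and> vars t \<subseteq> V \<and> t \<notin> P \<and>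
      (\<exists>u. vars u \<subseteq> V \<and> u \<notin> P \<and> u * (a * t - b * s) = 0)" for a s b t
  proof (cases "vars a \<subseteq> V \<and> vars s \<subseteq> V \<and> vars b \<subseteq> V \<and> vars t \<subseteq> V")
    case True
    then have "a * t \<ominus>\<^bsub>poly_ring V\<^esub> b * s = a * t - b * s"
      using vars_mult[of a t] vars_mult[of b s] by (intro minus_poly_ring) blast+
    then show ?thesis using True by (auto simp: loc_rel_def)
  qed (auto simp: loc_rel_def)
  have one: "1 \<notin> P" using P.one_imp_carrier P.I_notcarr by auto
  have prod: "u * v \<notin> P" if "vars u \<subseteq> V" "vars v \<subseteq> V" "u \<notin> P" "v \<notin> P" for u v
    using P.I_prime[of u v] that by auto
  have vmult: "vars (u * v) \<subseteq> V" if "vars u \<subseteq> V" "vars v \<subseteq> V" for u v :: "('v, 'k) mpoly"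
    using vars_mult[of u v] that by blast
  show ?thesis
  proof (intro iffI conjI)
    assume "f \<in> loc_contraction (poly_ring V) P (loc_extension (poly_ring V) P K)"
    then obtain a s where f: "vars f \<subseteq> V" and a: "a \<in> K" "vars s \<subseteq> V" "s \<notin> P"
      and eq: "loc_frac (poly_ring V) P f 1 = loc_frac (poly_ring V) P a s"
      unfolding loc_contraction_def loc_extension_def by auto
    show "vars f \<subseteq> V" by (rule f)
    have aV: "vars a \<subseteq> V" using a(1) K.Icarr by simp
    have "((a, s), (a, s)) \<in> loc_rel (poly_ring V) P"
      using aV a one by (auto simp: rel intro!: exI[of _ 1])
    then have "((f, 1), (a, s)) \<in> loc_rel (poly_ring V) P"
      using eq unfolding loc_frac_def by blast
    then obtain u where u: "vars u \<subseteq> V" "u \<notin> P" "u * (f * s - a * 1) = 0"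
      unfolding rel by blast
    then have "u * s * f = u * a" by (simp add: algebra_simps)
    moreover have "u * a \<in> K" using K.I_l_closed[OF a(1), of u] u(1) by simp
    ultimately show "\<exists>u. vars u \<subseteq> V \<and> u \<notin> P \<and> u * f \<in> K"
      using prod[OF u(1) a(2) u(2) a(3)] vmult[OF u(1) a(2)] by metis
  next
    assume *: "vars f \<subseteq> V \<and> (\<exists>u. vars u \<subseteq> V \<and> u \<notin> P \<and> u * f \<in> K)"
    then obtain u where u: "vars u \<subseteq> V" "u \<notin> P" "u * f \<in> K" by blast
    have "((f, 1), (b, t)) \<in> loc_rel (poly_ring V) P \<longleftrightarrow> ((u * f, u), (b, t)) \<in> loc_rel (poly_ring V) P" for b t
    proof
      assume "((f, 1), (b, t)) \<in> loc_rel (poly_ring V) P"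
      then obtain v where v: "vars v \<subseteq> V" "v \<notin> P" "v * (f * t - b * 1) = 0"
        "vars b \<subseteq> V" "vars t \<subseteq> V" "t \<notin> P" unfolding rel by blast
      have "v * (u * f * t - b * u) = u * (v * (f * t - b * 1))" by (simp add: algebra_simps)
      then have "v * (u * f * t - b * u) = 0" unfolding v(3) by simp
      then show "((u * f, u), (b, t)) \<in> loc_rel (poly_ring V) P"
        unfolding rel using v * u vmult by blast
    next
      assume "((u * f, u), (b, t)) \<in> loc_rel (poly_ring V) P"
      then obtain v where v: "vars v \<subseteq> V" "v \<notin> P" "v * (u * f * t - b * u) = 0"
        "vars b \<subseteq> V" "vars t \<subseteq> V" "t \<notin> P" unfolding rel by blast
      have "u * v * (f * t - b * 1) = v * (u * f * t - b * u)" by (simp add: algebra_simps)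
      then have "u * v * (f * t - b * 1) = 0" unfolding v(3) .
      then show "((f, 1), (b, t)) \<in> loc_rel (poly_ring V) P"
        unfolding rel using v * u vmult prod one vars_one by (metis empty_subsetI)
    qed
    then have "loc_frac (poly_ring V) P f 1 = loc_frac (poly_ring V) P (u * f) u"
      unfolding loc_frac_def by auto
    then show "f \<in> loc_contraction (poly_ring V) P (loc_extension (poly_ring V) P K)"
      unfolding loc_contraction_def loc_extension_def using u * by auto
  qed
qed

abbreviation variable_exponent :: "'v \<Rightarrow> 'v \<Rightarrow>\<^sub>0 nat"
  where "variable_exponent v \<equiv> Poly_Mapping.single v 1"

definition weight :: "'v set \<Rightarrow> ('v \<Rightarrow>\<^sub>0 nat) \<Rightarrow> nat"
  where "weight C t = (\<Sum>v\<in>C. Poly_Mapping.lookup t v)"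

lemma weight_add: "weight C (s + t) = weight C s + weight C t"
  by (simp add: weight_def lookup_add sum.distrib)

lemma weight_mono: "s \<preceq> t \<Longrightarrow> weight C s \<le> weight C t"
  unfolding weight_def exp_le_def by (intro sum_mono) blast

lemma weight_eq_0_iff: "finite C \<Longrightarrow> weight C t = 0 \<longleftrightarrow> Poly_Mapping.keys t \<inter> C = {}"
  by (auto simp: weight_def in_keys_iff)

lemma split_variable:
  assumes "v \<in> Poly_Mapping.keys t"
  obtains t' where "t = variable_exponent v + t'"
proof
  have "variable_exponent v \<preceq> t" using assms by (auto simp: exp_le_def lookup_single when_def in_keys_iff)
  then show "t = variable_exponent v + (t - variable_exponent v)"
    by (metis exp_le_diff_add add.commute)
qed

lemma prime_contains_variable:
  fixes P :: "('v, 'k::comm_ring_1) mpoly set"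
  assumes "finite V" and P: "primeideal P (poly_ring V)"
    and "Poly_Mapping.keys t \<subseteq> V" "monomial t \<in> P"
  shows "\<exists>v\<in>Poly_Mapping.keys t. monomial (variable_exponent v) \<in> P"
  using assms(3,4)
proof (induction "weight V t" arbitrary: t rule: less_induct)
  case less
  interpret P: primeideal P "poly_ring V" by fact
  have "t \<noteq> 0"
  proof
    assume "t = 0"
    then have "1 \<in> P" using less.prems(2) by simp
    then show False using P.one_imp_carrier P.I_notcarr by auto
  qed
  then obtain v where v: "v \<in> Poly_Mapping.keys t" by (metis ex_in_conv keys_eq_empty)
  then obtain t' where t': "t = variable_exponent v + t'" by (rule split_variable)
  have keys: "Poly_Mapping.keys t = insert v (Poly_Mapping.keys t')" unfolding t' keys_add_nat by simp
  then have kV: "v \<in> V" "Poly_Mapping.keys t' \<subseteq> V" using less.prems(1) by auto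
  have "(monomial t :: ('v, 'k) mpoly) = monomial (variable_exponent v) * monomial t'" by (simp add: t' mult_single)
  then have "monomial (variable_exponent v) \<in> P \<or> monomial t' \<in> P"
    using P.I_prime[of "monomial (variable_exponent v)" "monomial t'"] less.prems(2) kV
    by (auto simp: vars_def split: if_splits)
  moreover have "weight V t' < weight V t"
  proof -
    have "weight V (variable_exponent v) \<noteq> 0"
      using weight_eq_0_iff[OF assms(1), of "variable_exponent v"] kV by simp
    then show ?thesis by (simp add: t' weight_add)
  qed
  ultimately show ?case using less.hyps[of t'] kV keys by auto
qed

definition vertex_cover :: "('v \<Rightarrow>\<^sub>0 nat) set \<Rightarrow> 'v set \<Rightarrow> bool"
  where "vertex_cover G C \<longleftrightarrow> (\<forall>g\<in>G. Poly_Mapping.keys g \<inter> C \<noteq> {})"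

text \<open>The ideal generated by the variables in \<open>C\<close>.\<close>

definition variable_ideal :: "'v set \<Rightarrow> 'v set \<Rightarrow> ('v, 'k::comm_ring_1) mpoly set"
  where "variable_ideal V C = monomial_ideal V (variable_exponent ` C)"

lemma mem_variable_ideal:
  "p \<in> variable_ideal V C \<longleftrightarrow> vars p \<subseteq> V \<and> (\<forall>t\<in>Poly_Mapping.keys p. Poly_Mapping.keys t \<inter> C \<noteq> {})"
proof -
  have "variable_exponent v \<preceq> t \<longleftrightarrow> v \<in> Poly_Mapping.keys t" for v and t :: "'a \<Rightarrow>\<^sub>0 nat"
    by (auto simp: exp_le_def lookup_single when_def in_keys_iff)
  then have "(\<exists>e\<in>variable_exponent ` C. e \<preceq> t) \<longleftrightarrow> Poly_Mapping.keys t \<inter> C \<noteq> {}" for t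
    by (auto simp del: One_nat_def)
  then show ?thesis by (simp add: variable_ideal_def monomial_ideal_def vars_subset_iff ball_conj_distrib)
qed

lemma primeideal_variable_ideal:
  assumes "finite C"
  shows "primeideal (variable_ideal V C :: ('v, 'k::idom) mpoly set) (poly_ring V)"
proof (rule primeidealI)
  show "ideal (variable_ideal V C :: ('v, 'k) mpoly set) (poly_ring V)"
    unfolding variable_ideal_def by (rule ideal_monomial_ideal)
  have "(1 :: ('v, 'k) mpoly) \<notin> variable_ideal V C" by (simp add: mem_variable_ideal)
  moreover have "(1 :: ('v, 'k) mpoly) \<in> carrier (poly_ring V)" by simp
  ultimately show "carrier (poly_ring V) \<noteq> (variable_ideal V C :: ('v, 'k) mpoly set)" by metis
  fix p q :: "('v, 'k) mpoly"
  assume pq: "p \<in> carrier (poly_ring V)" "q \<in> carrier (poly_ring V)"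
    "p \<otimes>\<^bsub>poly_ring V\<^esub> q \<in> variable_ideal V C"
  show "p \<in> variable_ideal V C \<or> q \<in> variable_ideal V C"
  proof (rule ccontr)
    assume "\<not> ?thesis"
    then obtain s t where st: "s \<in> Poly_Mapping.keys p" "weight C s = 0" "t \<in> Poly_Mapping.keys q" "weight C t = 0"
      using pq(1,2) weight_eq_0_iff[OF assms] by (auto simp: mem_variable_ideal)
    then have "p \<noteq> 0" "q \<noteq> 0" by auto
    then obtain a b where "a \<in> Poly_Mapping.keys p" "b \<in> Poly_Mapping.keys q"
      "\<And>s. s \<in> Poly_Mapping.keys p \<Longrightarrow> weight C a \<le> weight C s"
      "\<And>t. t \<in> Poly_Mapping.keys q \<Longrightarrow> weight C b \<le> weight C t"
      "a + b \<in> Poly_Mapping.keys (p * q)"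
      using min_weight_term_mult[of "weight C" p q] weight_add by blast
    then have "weight C (a + b) = 0" "a + b \<in> Poly_Mapping.keys (p * q)"
      using st by (fastforce simp: weight_add)+
    then show False using pq(3) weight_eq_0_iff[OF assms] by (auto simp: mem_variable_ideal)
  qed
qed (rule cring_poly_ring)

lemma monomial_ideal_subset_variable_ideal:
  "vertex_cover G C \<Longrightarrow> monomial_ideal V G \<subseteq> variable_ideal V C"
proof
  fix p assume C: "vertex_cover G C" and p: "p \<in> monomial_ideal V G"
  have "Poly_Mapping.keys t \<inter> C \<noteq> {}" if t: "t \<in> Poly_Mapping.keys p" for t
  proof -
    obtain g where g: "g \<in> G" "g \<preceq> t" using p t unfolding monomial_ideal_def by blast
    then show ?thesis using C keys_mono[OF g(2)] unfolding vertex_cover_def by blast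
  qed
  then show "p \<in> variable_ideal V C" using monomial_ideal_vars[OF p] by (simp add: mem_variable_ideal)
qed

definition minimal_cover :: "('v \<Rightarrow>\<^sub>0 nat) set \<Rightarrow> 'v set \<Rightarrow> bool"
  where "minimal_cover G C \<longleftrightarrow> vertex_cover G C \<and> (\<forall>D\<subset>C. \<not> vertex_cover G D)"

text \<open>If no generator meets \<open>C\<close> in \<open>k\<close> alone, then \<open>C - {k}\<close> is still a cover.\<close>

lemma minimal_cover_private:
  assumes "minimal_cover G C" "k \<in> C"
  obtains g where "g \<in> G" "Poly_Mapping.keys g \<inter> C = {k}"
proof -
  have "C - {k} \<subset> C" using assms(2) by blast
  then have "\<not> vertex_cover G (C - {k})" "vertex_cover G C" using assms(1) unfolding minimal_cover_def by blast+
  then obtain g where "g \<in> G" "Poly_Mapping.keys g \<inter> (C - {k}) = {}" "Poly_Mapping.keys g \<inter> C \<noteq> {}"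
    unfolding vertex_cover_def by blast
  then show thesis using that by blast
qed

lemma minimal_cover_exists:
  assumes "finite C" "vertex_cover G C"
  obtains D where "D \<subseteq> C" "minimal_cover G D"
proof -
  let ?S = "{D. D \<subseteq> C \<and> vertex_cover G D}"
  have "finite ?S" by (rule finite_subset[of _ "Pow C"]) (use assms in auto)
  moreover have "C \<in> ?S" using assms by blast
  ultimately have "\<exists>D\<in>?S. D \<subseteq> C \<and> (\<forall>D'\<in>?S. D' \<subseteq> D \<longrightarrow> D = D')"
    by (rule finite_has_minimal2)
  then obtain D where D: "D \<subseteq> C" "vertex_cover G D" "\<forall>D'\<in>?S. D' \<subseteq> D \<longrightarrow> D = D'" by blast
  have "\<not> vertex_cover G D'" if "D' \<subset> D" for D'
  proof
    assume "vertex_cover G D'"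
    then have "D' \<in> ?S" using that D(1) by blast
    then show False using D(3) that by blast
  qed
  then have "minimal_cover G D" using D(2) unfolding minimal_cover_def by blast
  then show thesis using D(1) that by blast
qed

text \<open>A prime that contains the generator meeting \<open>C\<close> in \<open>k\<close> alone contains one of its variables; if the prime
lies in the ideal of \<open>C\<close>, this variable can only be \<open>k\<close>.\<close>

lemma variable_ideal_minimal_prime:
  assumes "finite V" "C \<subseteq> V" and G: "\<And>g. g \<in> G \<Longrightarrow> Poly_Mapping.keys g \<subseteq> V" and C: "minimal_cover G C"
  shows "(variable_ideal V C :: ('v, 'k::idom) mpoly set) \<in> minimal_primes (poly_ring V) (monomial_ideal V G)"
  unfolding minimal_primes_def
proof (intro CollectI conjI allI impI)
  have finC: "finite C" using assms(1,2) finite_subset by blast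
  show "primeideal (variable_ideal V C :: ('v, 'k) mpoly set) (poly_ring V)"
    by (rule primeideal_variable_ideal[OF finC])
  show "monomial_ideal V G \<subseteq> (variable_ideal V C :: ('v, 'k) mpoly set)"
    using C monomial_ideal_subset_variable_ideal unfolding minimal_cover_def by blast
  fix Q :: "('v, 'k) mpoly set"
  assume Q: "primeideal Q (poly_ring V) \<and> monomial_ideal V G \<subseteq> Q \<and> Q \<subseteq> variable_ideal V C"
  have "variable_ideal V C \<subseteq> Q"
    unfolding variable_ideal_def
  proof (rule monomial_ideal_minimal)
    show "ideal Q (poly_ring V)" using Q by (auto simp: primeideal_def)
    fix e assume "e \<in> variable_exponent ` C"
    then obtain k where k: "e = variable_exponent k" "k \<in> C" by blast
    obtain g where g: "g \<in> G" "Poly_Mapping.keys g \<inter> C = {k}"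
      using minimal_cover_private[OF C k(2)] by blast
    have "(monomial g :: ('v, 'k) mpoly) \<in> monomial_ideal V G"
      using g(1) G by (intro monomial_mem_monomial_ideal)
    then obtain v where v: "v \<in> Poly_Mapping.keys g" "monomial (variable_exponent v) \<in> Q"
      using prime_contains_variable[OF assms(1), of Q g] Q G[OF g(1)] by blast
    have "monomial (variable_exponent v) \<in> (variable_ideal V C :: ('v, 'k) mpoly set)"
      using v(2) Q by blast
    then have "v \<in> C" by (simp add: mem_variable_ideal)
    then have "v = k" using v(1) g(2) by blast
    then show "monomial e \<in> Q" using v(2) k(1) by simp
  qed
  then show "Q = variable_ideal V C" using Q by blast
qed

text \<open>After inverting the variables outside \<open>C\<close>, every variable in \<open>C\<close> becomes a multiple of a generator,
namely of the one that meets \<open>C\<close> in this variable alone. Being square-free, that generator divides the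
variable times the product of all variables outside \<open>C\<close>; so for each of \<open>r\<close> variables of \<open>C\<close> in the
monomial one copy of this product is spent.\<close>

lemma exponent_above_sum:
  assumes G: "\<And>g. g \<in> G \<Longrightarrow> Poly_Mapping.keys g \<subseteq> V" "\<And>g v. g \<in> G \<Longrightarrow> Poly_Mapping.lookup g v \<le> 1"
    and V: "finite V" and C: "minimal_cover G C"
  shows "r \<le> weight C t \<Longrightarrow> \<exists>e\<in>sums_of r G. e \<preceq> r \<star> (\<Sum>v\<in>V - C. variable_exponent v) + t"
proof (induction r arbitrary: t)
  case 0
  show ?case by (simp add: exp_le_def)
next
  case (Suc r)
  let ?y = "\<Sum>v\<in>V - C. variable_exponent v"
  have "weight C t \<noteq> 0" using Suc.prems by simp
  then obtain k where k: "k \<in> C" "k \<in> Poly_Mapping.keys t"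
    unfolding weight_def by (metis in_keys_iff sum.neutral)
  have "finite C" using \<open>weight C t \<noteq> 0\<close> unfolding weight_def by (metis sum.infinite)
  obtain t' where t': "t = variable_exponent k + t'" using split_variable[OF k(2)] by blast
  have "weight C (variable_exponent k) = 1"
    using k(1) \<open>finite C\<close> by (simp add: weight_def lookup_single when_def)
  then have "r \<le> weight C t'" using Suc.prems by (simp add: t' weight_add)
  then obtain e where e: "e \<in> sums_of r G" "e \<preceq> r \<star> ?y + t'" using Suc.IH by blast
  obtain g where g: "g \<in> G" "Poly_Mapping.keys g \<inter> C = {k}"
    using minimal_cover_private[OF C k(1)] by blast
  have y: "Poly_Mapping.lookup ?y v = (if v \<in> V - C then 1 else 0)" for v
    using V by (simp add: lookup_sum lookup_single when_def)
  have "g \<preceq> ?y + variable_exponent k"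
    unfolding exp_le_def
  proof
    fix v
    show "Poly_Mapping.lookup g v \<le> Poly_Mapping.lookup (?y + variable_exponent k) v"
    proof (cases "v \<in> Poly_Mapping.keys g")
      case True
      then have "v = k \<or> v \<in> V - C" using g G(1) by blast
      then have "1 \<le> Poly_Mapping.lookup (?y + variable_exponent k) v"
        unfolding lookup_add y by (auto simp: lookup_single)
      then show ?thesis using G(2)[OF g(1), of v] le_trans by blast
    qed (simp add: in_keys_iff)
  qed
  then have "e + g \<preceq> (r \<star> ?y + t') + (?y + variable_exponent k)" using e(2) by (rule exp_le_add_mono[rotated])
  moreover have "(r \<star> ?y + t') + (?y + variable_exponent k) = Suc r \<star> ?y + t"
    by (simp add: multiple_Suc t' ac_simps)
  moreover have "e + g \<in> sums_of (Suc r) G" using e(1) g(1) unfolding sums_of_Suc by blast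
  ultimately show ?case by metis
qed

definition cover_exponents :: "'v set \<Rightarrow> ('v \<Rightarrow>\<^sub>0 nat) set \<Rightarrow> nat \<Rightarrow> ('v \<Rightarrow>\<^sub>0 nat) set"
  where "cover_exponents V G r = {t. \<forall>C\<subseteq>V. vertex_cover G C \<longrightarrow> r \<le> weight C t}"

lemma cover_exponents_upward_closed:
  assumes "b \<in> cover_exponents V G r" "b \<preceq> c" shows "c \<in> cover_exponents V G r"
  using assms(1) le_trans[OF _ weight_mono[OF assms(2)]] unfolding cover_exponents_def by simp

text \<open>For the inclusion from left to right, take a minimal cover \<open>D\<close> inside \<open>C\<close> and localize at its prime:
with \<open>u * f\<close> in the \<open>r\<close>-th power and \<open>u\<close> outside the prime, terms of least weight on \<open>D\<close> give
the bound for \<open>f\<close>, as \<open>u\<close> has a term of weight \<open>0\<close>. For the converse, the variables in a minimal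
prime form a minimal cover, and \<open>exponent_above_sum\<close> provides the multiplier.\<close>

theorem symbolic_power_monomial_ideal:
  assumes V: "finite V" and G: "\<And>g. g \<in> G \<Longrightarrow> Poly_Mapping.keys g \<subseteq> V"
    and sqfree: "\<And>g v. g \<in> G \<Longrightarrow> Poly_Mapping.lookup g v \<le> 1"
  shows "symbolic_power (poly_ring V) (monomial_ideal V G) r =
    (monomial_ideal V (cover_exponents V G r) :: ('v, 'k::idom) mpoly set)"
proof (intro equalityI subsetI)
  have pow: "ideal_pow (poly_ring V) (monomial_ideal V G) r =
      (monomial_ideal V (sums_of r G) :: ('v, 'k) mpoly set)"
    by (rule ideal_pow_monomial_ideal) (rule G)
  have mem: "f \<in> monomial_ideal V (cover_exponents V G r) \<longleftrightarrow>
      vars f \<subseteq> V \<and> Poly_Mapping.keys f \<subseteq> cover_exponents V G r" for f :: "('v, 'k) mpoly"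
    by (rule mem_monomial_ideal_upward_closed) (rule cover_exponents_upward_closed)
  {
    fix f :: "('v, 'k) mpoly"
    assume f: "f \<in> symbolic_power (poly_ring V) (monomial_ideal V G) r"
    have "r \<le> weight C t" if t: "t \<in> Poly_Mapping.keys f" and CV: "C \<subseteq> V" and C: "vertex_cover G C" for t C
    proof -
      have finC: "finite C" using V CV finite_subset by blast
      obtain D where D: "D \<subseteq> C" "minimal_cover G D" using minimal_cover_exists[OF finC C] by blast
      have DV: "D \<subseteq> V" "finite D" using D CV finC finite_subset by blast+
      let ?P = "variable_ideal V D :: ('v, 'k) mpoly set"
      have P: "?P \<in> minimal_primes (poly_ring V) (monomial_ideal V G)"
        by (rule variable_ideal_minimal_prime[OF V DV(1) G D(2)])
      then have "f \<in> loc_contraction (poly_ring V) ?P (loc_extension (poly_ring V) ?P (monomial_ideal V (sums_of r G)))"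
        using f unfolding symbolic_power_def pow by blast
      then obtain u where u: "vars u \<subseteq> V" "u \<notin> ?P" "u * f \<in> monomial_ideal V (sums_of r G)"
        using loc_contraction_extension_iff[OF ideal_monomial_ideal primeideal_variable_ideal[OF DV(2)]] by blast
      obtain s where s: "s \<in> Poly_Mapping.keys u" "weight D s = 0"
        using u(1,2) weight_eq_0_iff[OF DV(2)] by (auto simp: mem_variable_ideal)
      have "u \<noteq> 0" "f \<noteq> 0" using s t by auto
      then obtain a b where ab: "a \<in> Poly_Mapping.keys u" "b \<in> Poly_Mapping.keys f"
        "\<And>s. s \<in> Poly_Mapping.keys u \<Longrightarrow> weight D a \<le> weight D s"
        "\<And>t. t \<in> Poly_Mapping.keys f \<Longrightarrow> weight D b \<le> weight D t"
        "a + b \<in> Poly_Mapping.keys (u * f)"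
        using min_weight_term_mult[of "weight D" u f] weight_add by blast
      obtain e where e: "e \<in> sums_of r G" "e \<preceq> a + b" using u(3) ab(5) unfolding monomial_ideal_def by blast
      have one: "1 \<le> weight D g" if "g \<in> G" for g
        using D(2) that weight_eq_0_iff[OF DV(2), of g] unfolding minimal_cover_def vertex_cover_def
        by (metis less_one not_le)
      have "size M \<le> weight D (\<Sum>\<^sub># M)" if "set_mset M \<subseteq> G" for M
        using that
      proof (induction M)
        case (add g M)
        then show ?case using one[of g] by (simp add: weight_add)
      qed simp
      moreover obtain M where "e = \<Sum>\<^sub># M" "set_mset M \<subseteq> G" "size M = r"
        using e(1) unfolding sums_of_def by blast
      ultimately have "r \<le> weight D e" by metis
      also have "\<dots> \<le> weight D a + weight D b" using weight_mono[OF e(2)] by (simp add: weight_add)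
      also have "weight D a = 0" using ab(3)[OF s(1)] s(2) by simp
      also have "0 + weight D b \<le> weight D t" using ab(4)[OF t] by simp
      also have "\<dots> \<le> weight C t" unfolding weight_def using D(1) finC by (intro sum_mono2) auto
      finally show ?thesis .
    qed
    then have "Poly_Mapping.keys f \<subseteq> cover_exponents V G r" unfolding cover_exponents_def by blast
    moreover have "vars f \<subseteq> V" using f unfolding symbolic_power_def by simp
    ultimately show "f \<in> monomial_ideal V (cover_exponents V G r)" using mem by blast
  next
    fix f :: "('v, 'k) mpoly"
    assume "f \<in> monomial_ideal V (cover_exponents V G r)"
    then have f: "vars f \<subseteq> V" "Poly_Mapping.keys f \<subseteq> cover_exponents V G r" using mem by blast+
    have "f \<in> loc_contraction (poly_ring V) P (loc_extension (poly_ring V) P (monomial_ideal V (sums_of r G)))"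
      if "P \<in> minimal_primes (poly_ring V) (monomial_ideal V G)" for P
    proof -
      have P: "primeideal P (poly_ring V)" "monomial_ideal V G \<subseteq> P"
        and Pmin: "\<And>Q. primeideal Q (poly_ring V) \<Longrightarrow> monomial_ideal V G \<subseteq> Q \<Longrightarrow> Q \<subseteq> P \<Longrightarrow> Q = P"
        using that unfolding minimal_primes_def by blast+
      have idP: "ideal P (poly_ring V)" using P(1) by (simp add: primeideal_def)
      define C where "C = {v \<in> V. monomial (variable_exponent v) \<in> P}"
      have CV: "C \<subseteq> V" unfolding C_def by blast
      have "Poly_Mapping.keys g \<inter> C \<noteq> {}" if g: "g \<in> G" for g
      proof -
        have "(monomial g :: ('v, 'k) mpoly) \<in> monomial_ideal V G"
          using g G by (intro monomial_mem_monomial_ideal)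
        then show ?thesis
          using prime_contains_variable[OF V P(1) G[OF g]] P(2) G[OF g] unfolding C_def by blast
      qed
      then have cover: "vertex_cover G C" unfolding vertex_cover_def by blast
      have "\<not> vertex_cover G D" if D: "D \<subset> C" for D
      proof
        assume cD: "vertex_cover G D"
        have "finite D" using D CV V by (meson finite_subset psubset_imp_subset)
        moreover have "variable_ideal V D \<subseteq> P"
          unfolding variable_ideal_def by (rule monomial_ideal_minimal[OF idP]) (use D C_def in auto)
        ultimately have "variable_ideal V D = P"
          using Pmin primeideal_variable_ideal monomial_ideal_subset_variable_ideal[OF cD] by blast
        moreover obtain k where k: "k \<in> C" "k \<notin> D" using D by blast
        ultimately have "(monomial (variable_exponent k) :: ('v, 'k) mpoly) \<in> variable_ideal V D"
          unfolding C_def by blast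
        then show False using k(2) by (simp add: mem_variable_ideal)
      qed
      then have C: "minimal_cover G C" using cover unfolding minimal_cover_def by blast
      \<comment> \<open>the \<open>r\<close>-th power of the product of the variables outside \<open>C\<close>, which are units in the localization\<close>
      define z where "z = r \<star> (\<Sum>v\<in>V - C. variable_exponent v)"
      have zk: "Poly_Mapping.keys z \<subseteq> V - C"
        using V by (auto simp: z_def in_keys_iff lookup_sum lookup_single when_def split: if_splits)
      have "monomial z \<notin> P"
        using prime_contains_variable[OF V P(1), of z] zk unfolding C_def by blast
      moreover have "vars (monomial z :: ('v, 'k) mpoly) \<subseteq> V" using zk by (auto simp: vars_def)
      moreover have "monomial z * f \<in> monomial_ideal V (sums_of r G)"
      proof (rule monomial_idealI)
        fix s assume "s \<in> Poly_Mapping.keys (monomial z * f)"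
        then obtain t where t: "s = z + t" "t \<in> Poly_Mapping.keys f"
          using keys_mult[of "monomial z" f] by auto
        have "r \<le> weight C t" using f(2) t(2) CV cover unfolding cover_exponents_def by blast
        then have "\<exists>e\<in>sums_of r G. e \<preceq> s"
          unfolding t(1) z_def using exponent_above_sum[of G V C r t] G sqfree V C by blast
        moreover have "Poly_Mapping.keys s \<subseteq> V"
          using zk f(1) t by (auto simp: keys_add_nat vars_subset_iff)
        ultimately show "Poly_Mapping.keys s \<subseteq> V \<and> (\<exists>e\<in>sums_of r G. e \<preceq> s)" by blast
      qed
      ultimately show ?thesis
        using loc_contraction_extension_iff[OF ideal_monomial_ideal P(1)] f(1) by blast
    qed
    then show "f \<in> symbolic_power (poly_ring V) (monomial_ideal V G) r"
      unfolding symbolic_power_def pow using f(1) by auto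
  }
qed

section \<open>Comparison with the extremal ideal\<close>

text \<open>If a substitution maps monomials to monomials, comparing the image of a monomial ideal with
another monomial ideal is a matter of exponents only: the image must stay inside, and each exponent of the
target must lie above an image.\<close>

lemma genideal_subst_monomial_ideal:
  fixes h :: "'v \<Rightarrow> ('w, 'k::comm_ring_1) mpoly"
  assumes mon: "\<And>t. Poly_Mapping.keys t \<subseteq> U \<Longrightarrow> monom_subst h t = monomial (\<phi> t)"
    and keys: "\<And>t. Poly_Mapping.keys (\<phi> t) \<subseteq> V"
    and E: "\<And>b c. b \<in> E \<Longrightarrow> b \<preceq> c \<Longrightarrow> c \<in> E"
    and to: "\<And>t. Poly_Mapping.keys t \<subseteq> U \<Longrightarrow> t \<in> E \<Longrightarrow> \<phi> t \<in> F"
    and lift: "\<And>a. Poly_Mapping.keys a \<subseteq> V \<Longrightarrow> a \<in> F \<Longrightarrow>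
      \<exists>t\<in>E. Poly_Mapping.keys t \<subseteq> U \<and> \<phi> t \<preceq> a"
    and F: "\<And>b c. b \<in> F \<Longrightarrow> b \<preceq> c \<Longrightarrow> c \<in> F"
  shows "Idl\<^bsub>poly_ring V\<^esub> (poly_subst h ` monomial_ideal U E) = monomial_ideal V F"
proof -
  let ?E = "\<phi> ` {t \<in> E. Poly_Mapping.keys t \<subseteq> U}"
  have "Idl\<^bsub>poly_ring V\<^esub> (poly_subst h ` monomial_ideal U E) = monomial_ideal V ?E"
  proof (rule genideal_eq_monomial_ideal)
    show "poly_subst h ` monomial_ideal U E \<subseteq> monomial_ideal V ?E"
    proof (intro image_subsetI)
      fix p :: "('v, 'k) mpoly" assume "p \<in> monomial_ideal U E"
      then have p: "Poly_Mapping.keys t \<subseteq> U" "t \<in> E" if "t \<in> Poly_Mapping.keys p" for t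
        using that mem_monomial_ideal_upward_closed[of E p U] E unfolding vars_subset_iff by blast+
      have "const (Poly_Mapping.lookup p t) * monom_subst h t \<in> monomial_ideal V ?E"
        if t: "t \<in> Poly_Mapping.keys p" for t
      proof -
        have "monomial (\<phi> t) \<in> (monomial_ideal V ?E :: ('w, 'k) mpoly set)"
          using p[OF t] keys by (intro monomial_mem_monomial_ideal) auto
        then show ?thesis
          unfolding mon[OF p(1)[OF t]] by (rule monomial_ideal_mult_left[rotated]) simp
      qed
      then show "poly_subst h p \<in> monomial_ideal V ?E"
        unfolding poly_subst_def by (rule monomial_ideal_sum)
    qed
    fix e assume "e \<in> ?E"
    then obtain t where t: "e = \<phi> t" "t \<in> E" "Poly_Mapping.keys t \<subseteq> U" by blast
    have "poly_subst h (monomial t) = monomial e" using mon[OF t(3)] t(1) by (simp add: poly_subst_single)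
    moreover have "(monomial t :: ('v, 'k) mpoly) \<in> monomial_ideal U E"
      using t(2,3) by (rule monomial_mem_monomial_ideal)
    ultimately show "monomial e \<in> poly_subst h ` monomial_ideal U E" by (metis imageI)
  qed
  also have "\<dots> = monomial_ideal V F"
  proof -
    have "(\<exists>e\<in>?E. e \<preceq> t) \<longleftrightarrow> (\<exists>e\<in>F. e \<preceq> t)" if "Poly_Mapping.keys t \<subseteq> V" for t
    proof
      assume "\<exists>e\<in>?E. e \<preceq> t"
      then show "\<exists>e\<in>F. e \<preceq> t" using to by blast
    next
      assume "\<exists>e\<in>F. e \<preceq> t"
      then have "t \<in> F" using F by blast
      then show "\<exists>e\<in>?E. e \<preceq> t" using lift[OF that] by blast
    qed
    then show ?thesis unfolding monomial_ideal_def by blast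
  qed
  finally show ?thesis .
qed

locale squarefree_exponents =
  fixes n q :: nat and g :: "nat \<Rightarrow> (nat \<Rightarrow>\<^sub>0 nat)"
  assumes keys_g: "j \<in> {1..q} \<Longrightarrow> Poly_Mapping.keys (g j) \<subseteq> {1..n}"
    and g_le_1: "j \<in> {1..q} \<Longrightarrow> Poly_Mapping.lookup (g j) v \<le> 1"
begin

definition support :: "nat \<Rightarrow> nat set"
  where "support k = {j \<in> {1..q}. k \<in> Poly_Mapping.keys (g j)}"

definition subsets :: "nat set set"
  where "subsets = {A. A \<noteq> {} \<and> A \<subseteq> {1..q}}"

definition extremal_exponent :: "nat \<Rightarrow> (nat set \<Rightarrow>\<^sub>0 nat)"
  where "extremal_exponent i = (\<Sum>A\<in>{A. A \<subseteq> {1..q} \<and> i \<in> A}. Poly_Mapping.single A 1)"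

text \<open>The effect of \<open>\<psi>\<close> on exponents. A variable that divides no generator has empty support, which indexes no
variable of the extremal ring, and it does not occur in the image.\<close>

definition pullback :: "(nat set \<Rightarrow>\<^sub>0 nat) \<Rightarrow> (nat \<Rightarrow>\<^sub>0 nat)"
  where "pullback t = (\<Sum>k\<in>{1..n}. Poly_Mapping.single k (Poly_Mapping.lookup t (support k)))"

lemma lookup_g: "j \<in> {1..q} \<Longrightarrow> Poly_Mapping.lookup (g j) k = (if j \<in> support k then 1 else 0)"
  using g_le_1[of j k] by (auto simp: support_def in_keys_iff)

lemma finite_subsets: "finite subsets"
  unfolding subsets_def by (rule finite_subset[of _ "Pow {1..q}"]) auto

lemma lookup_extremal_exponent: "Poly_Mapping.lookup (extremal_exponent i) A = (if A \<subseteq> {1..q} \<and> i \<in> A then 1 else 0)"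
proof -
  have "finite {A. A \<subseteq> {1..q} \<and> i \<in> A}" by (rule finite_subset[of _ "Pow {1..q}"]) auto
  then show ?thesis by (simp add: extremal_exponent_def lookup_sum lookup_single when_def)
qed

lemma keys_extremal_exponent: "Poly_Mapping.keys (extremal_exponent i) = {A. A \<subseteq> {1..q} \<and> i \<in> A}"
  unfolding set_eq_iff in_keys_iff lookup_extremal_exponent by simp

lemma keys_extremal_exponent_subset: "Poly_Mapping.keys (extremal_exponent i) \<subseteq> subsets"
  unfolding keys_extremal_exponent subsets_def by blast

lemma lookup_pullback: "Poly_Mapping.lookup (pullback t) k = (if k \<in> {1..n} then Poly_Mapping.lookup t (support k) else 0)"
  by (simp add: pullback_def lookup_sum lookup_single when_def)

lemma keys_pullback: "Poly_Mapping.keys (pullback t) \<subseteq> {1..n}"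
  by (auto simp: in_keys_iff lookup_pullback split: if_splits)

lemma support_subset: "support k \<subseteq> {1..q}"
  by (auto simp: support_def)

lemma pullback_add: "pullback (s + t) = pullback s + pullback t"
  by (rule poly_mapping_eqI) (simp add: lookup_add lookup_pullback)

lemma pullback_mono: "s \<preceq> t \<Longrightarrow> pullback s \<preceq> pullback t"
  by (simp add: exp_le_def lookup_pullback)

lemma pullback_0 [simp]: "pullback 0 = 0"
  by (rule poly_mapping_eqI) (simp add: lookup_pullback)

lemma pullback_extremal_exponent:
  assumes "j \<in> {1..q}" shows "pullback (extremal_exponent j) = g j"
proof (rule poly_mapping_eqI)
  fix k
  show "Poly_Mapping.lookup (pullback (extremal_exponent j)) k = Poly_Mapping.lookup (g j) k"
  proof (cases "k \<in> {1..n}")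
    case True
    then show ?thesis using support_subset[of k] by (auto simp: lookup_pullback lookup_extremal_exponent lookup_g[OF assms])
  next
    case False
    then show ?thesis using keys_g[OF assms] by (auto simp: lookup_pullback in_keys_iff)
  qed
qed

lemma pullback_sum_mset: "pullback (\<Sum>\<^sub># M) = \<Sum>\<^sub># (image_mset pullback M)"
  by (induction M) (simp_all add: pullback_add)

lemma pullback_sums_of:
  assumes "s \<in> sums_of r X" shows "pullback s \<in> sums_of r (pullback ` X)"
proof -
  obtain M where "s = \<Sum>\<^sub># M" "set_mset M \<subseteq> X" "size M = r" using assms unfolding sums_of_def by blast
  then have "pullback s = \<Sum>\<^sub># (image_mset pullback M)" "set_mset (image_mset pullback M) \<subseteq> pullback ` X"
    "size (image_mset pullback M) = r" by (auto simp: pullback_sum_mset)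
  then show ?thesis unfolding sums_of_def by blast
qed

lemma pullback_multiple: "pullback (c \<star> t) = c \<star> pullback t"
  by (rule poly_mapping_eqI) (simp add: lookup_pullback)

abbreviation "generators \<equiv> g ` {1..q}"
abbreviation "extremal_exponents \<equiv> extremal_exponent ` {1..q}"

lemma pullback_extremal_exponents: "pullback ` extremal_exponents = generators"
  using pullback_extremal_exponent by force

lemma pullback_newton:
  assumes "t \<in> newton (sums_of r extremal_exponents)" shows "pullback t \<in> newton (sums_of r generators)"
proof -
  obtain M where M: "M \<noteq> {#}" "set_mset M \<subseteq> sums_of r extremal_exponents" "\<Sum>\<^sub># M \<preceq> size M \<star> t"
    using assms by (rule newtonE)
  let ?M = "image_mset pullback M"
  have "set_mset ?M \<subseteq> sums_of r generators"
    using M(2) pullback_sums_of[of _ r extremal_exponents] unfolding pullback_extremal_exponents by auto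
  moreover have "\<Sum>\<^sub># ?M \<preceq> size ?M \<star> pullback t"
    using pullback_mono[OF M(3)] by (simp add: pullback_sum_mset pullback_multiple)
  moreover have "?M \<noteq> {#}" using M(1) by simp
  ultimately show ?thesis using newtonI by blast
qed

lemma sums_of_image_lift:
  assumes "s \<in> sums_of r generators"
  obtains s' where "s' \<in> sums_of r extremal_exponents" "pullback s' = s"
  using assms
proof (induction r arbitrary: s thesis)
  case 0
  show ?case by (rule "0.prems"(1)[of 0]) (use "0.prems" in auto)
next
  case (Suc r)
  obtain t j where t: "s = t + g j" "t \<in> sums_of r generators" "j \<in> {1..q}"
    using Suc.prems(2) unfolding sums_of_Suc by blast
  obtain t' where t': "t' \<in> sums_of r extremal_exponents" "pullback t' = t" using Suc.IH[OF _ t(2)] by blast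
  have "t' + extremal_exponent j \<in> sums_of (Suc r) extremal_exponents" using t'(1) t(3) unfolding sums_of_Suc by blast
  moreover have "pullback (t' + extremal_exponent j) = s" using t t' by (simp add: pullback_add pullback_extremal_exponent)
  ultimately show ?case using Suc.prems(1) by blast
qed

lemma multiset_image_lift:
  assumes "set_mset M \<subseteq> sums_of r generators"
  obtains M' where "set_mset M' \<subseteq> sums_of r extremal_exponents" "size M' = size M" "pullback (\<Sum>\<^sub># M') = \<Sum>\<^sub># M"
  using assms
proof (induction M arbitrary: thesis)
  case empty
  show ?case by (rule empty.prems(1)[of "{#}"]) simp_all
next
  case (add s M)
  then have *: "s \<in> sums_of r generators" "set_mset M \<subseteq> sums_of r generators" by simp_all
  obtain s' where s': "s' \<in> sums_of r extremal_exponents" "pullback s' = s" using *(1) by (rule sums_of_image_lift)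
  obtain M' where M': "set_mset M' \<subseteq> sums_of r extremal_exponents" "size M' = size M" "pullback (\<Sum>\<^sub># M') = \<Sum>\<^sub># M"
    by (rule add.IH[OF _ *(2)])
  show ?case by (rule add.prems(1)[of "add_mset s' M'"]) (use s' M' in \<open>simp_all add: pullback_add\<close>)
qed

text \<open>The multiset \<open>M\<close> witnessing that \<open>a\<close> lies in the polyhedron lifts to a multiset of exponents over the
extremal ideal; with \<open>s\<close> its sum and \<open>N\<close> its size, \<open>s / N\<close> rounded up is an integer
point of the lifted polyhedron. Its pullback stays below \<open>a\<close> because \<open>a\<close> is integral and so survives
the rounding.\<close>

lemma newton_lift:
  assumes a: "a \<in> newton (sums_of r generators)"
  shows "\<exists>t\<in>newton (sums_of r extremal_exponents). Poly_Mapping.keys t \<subseteq> subsets \<and> pullback t \<preceq> a"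
proof -
  obtain M where M: "M \<noteq> {#}" "set_mset M \<subseteq> sums_of r generators" "\<Sum>\<^sub># M \<preceq> size M \<star> a"
    using a by (rule newtonE)
  obtain M' where M': "set_mset M' \<subseteq> sums_of r extremal_exponents" "size M' = size M" "pullback (\<Sum>\<^sub># M') = \<Sum>\<^sub># M"
    using M(2) by (rule multiset_image_lift)
  define N where "N = size M"
  define s where "s = \<Sum>\<^sub># M'"
  have N: "N \<ge> 1" using M(1) by (simp add: N_def Suc_leI nonempty_has_size)
  have "Poly_Mapping.keys x \<subseteq> subsets" if "x \<in># M'" for x
    using M'(1) that keys_extremal_exponent_subset by (intro keys_sums_of[of x r extremal_exponents]) auto
  then have ks: "Poly_Mapping.keys s \<subseteq> subsets" unfolding s_def by (rule keys_sum_mset_subset)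
  define t where "t = (\<Sum>A\<in>subsets. Poly_Mapping.single A ((Poly_Mapping.lookup s A + (N - 1)) div N))"
  have t: "Poly_Mapping.lookup t A = (if A \<in> subsets then (Poly_Mapping.lookup s A + (N - 1)) div N else 0)" for A
    using finite_subsets by (simp add: t_def lookup_sum lookup_single when_def)
  have "s \<preceq> N \<star> t"
    unfolding exp_le_def
  proof
    fix A
    show "Poly_Mapping.lookup s A \<le> Poly_Mapping.lookup (N \<star> t) A"
    proof (cases "A \<in> subsets")
      case True
      have "Poly_Mapping.lookup s A + (N - 1) < N * ((Poly_Mapping.lookup s A + (N - 1)) div N) + N"
        using dividend_less_times_div[of N "Poly_Mapping.lookup s A + (N - 1)"] N by (simp add: add.commute)
      then show ?thesis using True N by (simp add: t)
    next
      case False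
      then have "A \<notin> Poly_Mapping.keys s" using ks by blast
      then show ?thesis by (simp add: in_keys_iff)
    qed
  qed
  then have "t \<in> newton (sums_of r extremal_exponents)"
    using M'(1,2) N by (intro newtonI[of M']) (auto simp: s_def N_def)
  moreover have "Poly_Mapping.keys t \<subseteq> subsets" by (auto simp: in_keys_iff t split: if_splits)
  moreover have "pullback t \<preceq> a"
    unfolding exp_le_def
  proof
    fix k
    show "Poly_Mapping.lookup (pullback t) k \<le> Poly_Mapping.lookup a k"
    proof (cases "k \<in> {1..n} \<and> support k \<in> subsets")
      case True
      then have "Poly_Mapping.lookup s (support k) = Poly_Mapping.lookup (\<Sum>\<^sub># M) k"
        using M'(3) unfolding s_def by (metis lookup_pullback)
      also have "\<dots> \<le> N * Poly_Mapping.lookup a k" using M(3) by (simp add: exp_le_def N_def)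
      finally have "(Poly_Mapping.lookup s (support k) + (N - 1)) div N < Poly_Mapping.lookup a k + 1"
        using N by (intro div_less_iff_less_mult[THEN iffD2]) (auto simp: algebra_simps)
      then show ?thesis using True by (simp add: lookup_pullback t)
    next
      case False
      then show ?thesis by (auto simp: lookup_pullback t)
    qed
  qed
  ultimately show ?thesis by blast
qed

text \<open>The supports of the members of a cover \<open>C\<close> form a cover of the extremal ideal. Passing from \<open>C\<close> to the
supports may identify members, which only decreases the weight.\<close>

lemma pullback_cover_exponents:
  assumes "t \<in> cover_exponents subsets extremal_exponents r"
  shows "pullback t \<in> cover_exponents {1..n} generators r"
  unfolding cover_exponents_def
proof (intro CollectI allI impI)
  fix C assume C: "C \<subseteq> {1..n}" "vertex_cover generators C"
  let ?D = "support ` C - {{}}"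
  have finC: "finite C" using C(1) finite_subset by blast
  have "?D \<subseteq> subsets" using support_subset unfolding subsets_def by blast
  moreover have "vertex_cover extremal_exponents ?D"
    unfolding vertex_cover_def
  proof
    fix e assume "e \<in> extremal_exponents"
    then obtain i where i: "i \<in> {1..q}" "e = extremal_exponent i" by blast
    then obtain k where k: "k \<in> C" "k \<in> Poly_Mapping.keys (g i)"
      using C(2) unfolding vertex_cover_def by blast
    then have "i \<in> support k" using i(1) by (simp add: support_def)
    then have "support k \<in> Poly_Mapping.keys (extremal_exponent i) \<inter> ?D"
      using k(1) support_subset by (auto simp: keys_extremal_exponent)
    then show "Poly_Mapping.keys e \<inter> ?D \<noteq> {}" unfolding i(2) by blast
  qed
  ultimately have "r \<le> weight ?D t" using assms unfolding cover_exponents_def by blast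
  also have "\<dots> \<le> (\<Sum>A\<in>support ` C. Poly_Mapping.lookup t A)"
    unfolding weight_def using finC by (intro sum_mono2) auto
  also have "\<dots> \<le> (\<Sum>k\<in>C. Poly_Mapping.lookup t (support k))"
    using sum_image_le[OF finC, of "Poly_Mapping.lookup t" support] by (simp add: o_def)
  also have "\<dots> = weight C (pullback t)"
    unfolding weight_def using C(1) by (intro sum.cong) (auto simp: lookup_pullback)
  finally show "r \<le> weight C (pullback t)" .
qed

text \<open>Given a cover \<open>D\<close> of the extremal ideal, choose for every \<open>A\<close> in \<open>D\<close> an index \<open>\<kappa> A\<close> that attains the
minimum defining the exponent at \<open>A\<close>; these indices are distinct and form a cover on which \<open>a\<close> has the same weight. If there is
no index with support \<open>A\<close>, the default value \<open>r\<close> alone makes the weight large enough.\<close>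

lemma cover_exponents_lift:
  assumes a: "a \<in> cover_exponents {1..n} generators r"
  shows "\<exists>t\<in>cover_exponents subsets extremal_exponents r. Poly_Mapping.keys t \<subseteq> subsets \<and> pullback t \<preceq> a"
proof -
  let ?S = "\<lambda>A. {k \<in> {1..n}. support k = A}"
  define c where "c A = (if ?S A = {} then r else Min (Poly_Mapping.lookup a ` ?S A))" for A
  define t where "t = (\<Sum>A\<in>subsets. Poly_Mapping.single A (c A))"
  have t: "Poly_Mapping.lookup t A = (if A \<in> subsets then c A else 0)" for A
    using finite_subsets by (simp add: t_def lookup_sum lookup_single when_def)
  have "t \<in> cover_exponents subsets extremal_exponents r"
    unfolding cover_exponents_def
  proof (intro CollectI allI impI)
    fix D assume D: "D \<subseteq> subsets" "vertex_cover extremal_exponents D"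
    have finD: "finite D" using D(1) finite_subsets finite_subset by blast
    show "r \<le> weight D t"
    proof (cases "\<exists>A\<in>D. ?S A = {}")
      case True
      then obtain A where A: "A \<in> D" "?S A = {}" by blast
      then have "r = Poly_Mapping.lookup t A" using D(1) by (auto simp: t c_def)
      also have "\<dots> \<le> weight D t" unfolding weight_def by (rule member_le_sum[OF A(1) _ finD]) simp
      finally show ?thesis .
    next
      case False
      have "\<forall>A\<in>D. \<exists>k. k \<in> ?S A \<and> Poly_Mapping.lookup a k = c A"
      proof
        fix A assume "A \<in> D"
        then have ne: "?S A \<noteq> {}" using False by blast
        then have "Min (Poly_Mapping.lookup a ` ?S A) \<in> Poly_Mapping.lookup a ` ?S A"
          by (intro Min_in) auto
        then show "\<exists>k. k \<in> ?S A \<and> Poly_Mapping.lookup a k = c A" using ne unfolding c_def by force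
      qed
      then obtain \<kappa> where "\<forall>A\<in>D. \<kappa> A \<in> ?S A \<and> Poly_Mapping.lookup a (\<kappa> A) = c A"
        using bchoice by meson
      then have \<kappa>: "\<kappa> A \<in> {1..n}" "support (\<kappa> A) = A" "Poly_Mapping.lookup a (\<kappa> A) = c A" if "A \<in> D" for A
        using that by blast+
      have inj: "inj_on \<kappa> D" by (rule inj_on_inverseI[of D support]) (rule \<kappa>(2))
      have "vertex_cover generators (\<kappa> ` D)"
        unfolding vertex_cover_def
      proof
        fix e assume "e \<in> generators"
        then obtain i where i: "i \<in> {1..q}" "e = g i" by blast
        then obtain A where A: "A \<in> D" "A \<in> Poly_Mapping.keys (extremal_exponent i)"
          using D(2) unfolding vertex_cover_def by blast
        then have "i \<in> support (\<kappa> A)" using \<kappa>(2)[OF A(1)] by (simp add: keys_extremal_exponent)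
        then have "\<kappa> A \<in> Poly_Mapping.keys e" unfolding i(2) support_def by blast
        then show "Poly_Mapping.keys e \<inter> \<kappa> ` D \<noteq> {}" using A(1) by blast
      qed
      moreover have "\<kappa> ` D \<subseteq> {1..n}" using \<kappa>(1) by blast
      ultimately have "r \<le> weight (\<kappa> ` D) a" using a unfolding cover_exponents_def by blast
      also have "\<dots> = (\<Sum>A\<in>D. Poly_Mapping.lookup a (\<kappa> A))"
        unfolding weight_def by (rule sum.reindex_cong[OF inj]) simp_all
      also have "\<dots> = weight D t"
        unfolding weight_def using \<kappa>(3) D(1) by (intro sum.cong) (auto simp: t)
      finally show ?thesis .
    qed
  qed
  moreover have "Poly_Mapping.keys t \<subseteq> subsets" by (auto simp: in_keys_iff t split: if_splits)
  moreover have "pullback t \<preceq> a"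
    unfolding exp_le_def
  proof
    fix k
    show "Poly_Mapping.lookup (pullback t) k \<le> Poly_Mapping.lookup a k"
    proof (cases "k \<in> {1..n}")
      case True
      then have "k \<in> ?S (support k)" by simp
      then have "c (support k) \<le> Poly_Mapping.lookup a k" unfolding c_def by auto
      then show ?thesis using True by (simp add: lookup_pullback t)
    next
      case False
      then have "Poly_Mapping.lookup (pullback t) k = 0" unfolding lookup_pullback by (rule if_not_P)
      then show ?thesis by simp
    qed
  qed
  ultimately show ?thesis by blast
qed

end

lemma prod_monomial: "(\<Prod>x\<in>A. monomial (e x)) = monomial (\<Sum>x\<in>A. e x)"
  by (induction A rule: infinite_finite_induct) (simp_all add: mult_single)

lemma var_power: "var v ^ c = (monomial (Poly_Mapping.single v c) :: ('v, 'k::comm_ring_1) mpoly)"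
  by (induction c) (simp_all add: var_def mult_single flip: single_add)

lemma var_divides_monomial_iff:
  assumes "k \<in> V" "Poly_Mapping.keys t \<subseteq> V"
  shows "var k divides\<^bsub>poly_ring V\<^esub> (monomial t :: ('v, 'k::comm_ring_1) mpoly) \<longleftrightarrow> k \<in> Poly_Mapping.keys t"
proof
  assume "var k divides\<^bsub>poly_ring V\<^esub> (monomial t :: ('v, 'k) mpoly)"
  then obtain p :: "('v, 'k) mpoly" where "monomial t = var k * p" unfolding factor_def by auto
  then have "t \<in> Poly_Mapping.keys (var k * p)" by (metis keys_single singletonI zero_neq_one)
  then obtain s where "t = Poly_Mapping.single k 1 + s"
    using keys_mult[of "var k" p] unfolding var_def by auto
  then show "k \<in> Poly_Mapping.keys t" by (simp add: keys_add_nat)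
next
  assume "k \<in> Poly_Mapping.keys t"
  then obtain s where s: "t = variable_exponent k + s" by (rule split_variable)
  then have "Poly_Mapping.keys s \<subseteq> V" using assms(2) by (simp add: keys_add_nat)
  then have "vars (monomial s :: ('v, 'k) mpoly) \<subseteq> V" by (simp add: vars_def)
  moreover have "(monomial t :: ('v, 'k) mpoly) = var k * monomial s"
    by (simp add: s var_def mult_single)
  ultimately show "var k divides\<^bsub>poly_ring V\<^esub> (monomial t :: ('v, 'k) mpoly)"
    unfolding factor_def by auto
qed

theorem theorem1:
  fixes n q r :: nat
    and m :: "nat \<Rightarrow> (nat, 'k::field) mpoly"
    and I :: "(nat, 'k) mpoly set"
  assumes "q \<ge> 1" and "r \<ge> 1"
    and "\<forall>j\<in>{1..q}. squarefree_monomial {1..n} (m j)"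
    and "inj_on m {1..q}"
    and "minimal_generating_set (poly_ring {1..n}) (m ` {1..q}) I"
  shows "integral_closure (poly_ring {1..n}) (ideal_pow (poly_ring {1..n}) I r) =
           Idl\<^bsub>poly_ring {1..n}\<^esub>
             (psi n q m ` integral_closure (extremal_ring q)
                (ideal_pow (extremal_ring q) (extremal_ideal q) r))
       \<and> symbolic_power (poly_ring {1..n}) I r =
           Idl\<^bsub>poly_ring {1..n}\<^esub>
             (psi n q m ` symbolic_power (extremal_ring q) (extremal_ideal q) r)"
proof -
  obtain g where "\<forall>j\<in>{1..q}. Poly_Mapping.keys (g j) \<subseteq> {1..n} \<and> (\<forall>v. Poly_Mapping.lookup (g j) v \<le> 1) \<and> m j = monomial (g j)"
    using assms(3) unfolding squarefree_monomial_def by metis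
  then have g: "Poly_Mapping.keys (g j) \<subseteq> {1..n}" "Poly_Mapping.lookup (g j) v \<le> 1" "m j = monomial (g j)"
    if "j \<in> {1..q}" for j v using that by blast+
  interpret squarefree_exponents n q g by unfold_locales (use g in auto)
  let ?R = "poly_ring {1..n} :: (nat, 'k) mpoly ring" and ?S = "poly_ring subsets :: (nat set, 'k) mpoly ring"
  have S: "extremal_ring q = ?S" by (simp add: extremal_ring_def subsets_def)
  have I: "I = monomial_ideal {1..n} generators"
  proof -
    have "Idl\<^bsub>?R\<^esub> (m ` {1..q}) = monomial_ideal {1..n} generators"
    proof (rule genideal_eq_monomial_ideal)
      show "m ` {1..q} \<subseteq> monomial_ideal {1..n} generators"
      proof (intro image_subsetI)
        fix j assume "j \<in> {1..q}"
        then show "m j \<in> monomial_ideal {1..n} generators"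
          unfolding g(3)[OF \<open>j \<in> {1..q}\<close>] by (intro monomial_mem_monomial_ideal imageI g(1))
      qed
      show "monomial e \<in> m ` {1..q}" if "e \<in> generators" for e using that g(3) by force
    qed
    then show ?thesis using assms(5) unfolding minimal_generating_set_def by simp
  qed
  have extremal_gen: "extremal_gen q i = (monomial (extremal_exponent i) :: (nat set, 'k) mpoly)" for i
    by (simp add: extremal_gen_def var_def prod_monomial extremal_exponent_def)
  have E: "extremal_ideal q = (monomial_ideal subsets extremal_exponents :: (nat set, 'k) mpoly set)"
    unfolding extremal_ideal_def S
  proof (rule genideal_eq_monomial_ideal)
    show "extremal_gen q ` {1..q} \<subseteq> (monomial_ideal subsets extremal_exponents :: (nat set, 'k) mpoly set)"
      unfolding extremal_gen using keys_extremal_exponent_subset by (auto intro!: monomial_mem_monomial_ideal)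
    show "monomial e \<in> (extremal_gen q ` {1..q} :: (nat set, 'k) mpoly set)" if "e \<in> extremal_exponents" for e
      using that unfolding extremal_gen by blast
  qed
  have psi_var: "psi_var n q m A = (\<Prod>k\<in>{k\<in>{1..n}. support k = A}. var k)" if "A \<in> subsets" for A
  proof -
    have "(\<forall>j\<in>{1..q}. var k divides\<^bsub>?R\<^esub> m j \<longleftrightarrow> j \<in> A) \<longleftrightarrow> support k = A" if k: "k \<in> {1..n}" for k
    proof -
      have "var k divides\<^bsub>?R\<^esub> m j \<longleftrightarrow> k \<in> Poly_Mapping.keys (g j)" if "j \<in> {1..q}" for j
        unfolding g(3)[OF that] by (rule var_divides_monomial_iff[OF k g(1)[OF that]])
      then show ?thesis using \<open>A \<in> subsets\<close> unfolding support_def subsets_def by auto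
    qed
    then show ?thesis unfolding psi_var_def by (intro prod.cong) auto
  qed
  have mon: "monom_subst (psi_var n q m) t = monomial (pullback t)" if t: "Poly_Mapping.keys t \<subseteq> subsets" for t
  proof -
    have "monom_subst (psi_var n q m) t = (\<Prod>A\<in>subsets. psi_var n q m A ^ Poly_Mapping.lookup t A)"
      using finite_subsets t by (rule monom_subst_superset)
    also have "\<dots> = (\<Prod>A\<in>subsets. monomial (\<Sum>k\<in>{k\<in>{1..n}. support k = A}. Poly_Mapping.single k (Poly_Mapping.lookup t A)))"
      by (rule prod.cong) (simp_all add: psi_var prod_power_distrib var_power prod_monomial)
    also have "\<dots> = monomial (\<Sum>A\<in>subsets. \<Sum>k\<in>{k\<in>{1..n}. support k = A}. Poly_Mapping.single k (Poly_Mapping.lookup t A))"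
      by (rule prod_monomial)
    also have "(\<Sum>A\<in>subsets. \<Sum>k\<in>{k\<in>{1..n}. support k = A}. Poly_Mapping.single k (Poly_Mapping.lookup t A)) = pullback t"
    proof (rule poly_mapping_eqI)
      fix k
      have "(\<Sum>k'\<in>{k'\<in>{1..n}. support k' = A}. Poly_Mapping.lookup t A when k' = k) =
        (if A = support k then (if k \<in> {1..n} then Poly_Mapping.lookup t A else 0) else 0)" for A
        by (auto simp: when_def)
      then show "Poly_Mapping.lookup (\<Sum>A\<in>subsets. \<Sum>k\<in>{k\<in>{1..n}. support k = A}. Poly_Mapping.single k (Poly_Mapping.lookup t A)) k
        = Poly_Mapping.lookup (pullback t) k"
        using finite_subsets t by (auto simp: lookup_sum lookup_single lookup_pullback in_keys_iff)
    qed
    finally show ?thesis .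
  qed
  have keys_sums: "Poly_Mapping.keys e \<subseteq> {1..n}" if "e \<in> sums_of r generators" for e
    using that by (rule keys_sums_of) (use keys_g in blast)
  have keys_sums': "Poly_Mapping.keys e \<subseteq> subsets" if "e \<in> sums_of r extremal_exponents" for e
    using that by (rule keys_sums_of) (use keys_extremal_exponent_subset in blast)
  have "ideal_pow ?R I r = monomial_ideal {1..n} (sums_of r generators)"
    unfolding I by (rule ideal_pow_monomial_ideal) (use keys_g in blast)
  then have "integral_closure ?R (ideal_pow ?R I r) = monomial_ideal {1..n} (newton (sums_of r generators))"
    using integral_closure_monomial_ideal[OF finite_sums_of[of generators r] keys_sums] by simp
  moreover have "ideal_pow ?S (extremal_ideal q) r = monomial_ideal subsets (sums_of r extremal_exponents)"
    unfolding E by (rule ideal_pow_monomial_ideal) (use keys_extremal_exponent_subset in blast)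
  then have "integral_closure ?S (ideal_pow ?S (extremal_ideal q) r) = monomial_ideal subsets (newton (sums_of r extremal_exponents))"
    using integral_closure_monomial_ideal[OF finite_sums_of[of extremal_exponents r] keys_sums'] by simp
  moreover have "Idl\<^bsub>?R\<^esub> (psi n q m ` monomial_ideal subsets (newton (sums_of r extremal_exponents))) = monomial_ideal {1..n} (newton (sums_of r generators))"
    unfolding psi_def
    by (rule genideal_subst_monomial_ideal[where \<phi> = pullback, OF mon keys_pullback newton_upward_closed _ _ newton_upward_closed])
       (use pullback_newton newton_lift in auto)
  moreover have "symbolic_power ?R I r = monomial_ideal {1..n} (cover_exponents {1..n} generators r)"
    unfolding I by (rule symbolic_power_monomial_ideal) (simp, use keys_g in blast, use g_le_1 in blast)
  moreover have "symbolic_power ?S (extremal_ideal q) r = monomial_ideal subsets (cover_exponents subsets extremal_exponents r)"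
    unfolding E by (rule symbolic_power_monomial_ideal) (use keys_extremal_exponent_subset finite_subsets lookup_extremal_exponent in auto)
  moreover have "Idl\<^bsub>?R\<^esub> (psi n q m ` monomial_ideal subsets (cover_exponents subsets extremal_exponents r)) = monomial_ideal {1..n} (cover_exponents {1..n} generators r)"
    unfolding psi_def
    by (rule genideal_subst_monomial_ideal[where \<phi> = pullback, OF mon keys_pullback cover_exponents_upward_closed _ _ cover_exponents_upward_closed])
       (use pullback_cover_exponents cover_exponents_lift in auto)
  ultimately show ?thesis unfolding S by simp
qed

end
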